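(* Let $k\ge1$ be a fixed real number, and let $c(k)$ be a constant such that, for every $\varepsilon>0$, $$ \int_0^T|E^*(t)|^{k}\,dt\;\ll_\varepsilon\;T^{c(k)+\varepsilon}\qquad(T\ge2). $$ Then, for every $\varepsilon>0$, $$ \int_0^T|\zeta(\tfrac12+it)|^{2k+2}\,dt\;\ll_\varepsilon\;T^{c(k)+\varepsilon}\qquad(T\ge2). $$
   Context: Let $d(n)$ be the number of positive divisors of $n$, let $\zeta(s)$ be the Riemann zeta-function, and let $\gamma=0.577215\ldots$ be Euler's constant. For $x>0$ put $$\Delta(x)=\sum_{n\le x}d(n)-x(\log x+2\gamma-1),$$ $$\Delta^*(x)=-\Delta(x)+2\Delta(2x)-\tfrac12\Delta(4x),$$ for $T>0$ put $$E(T)=\int_0^T|\zeta(\tfrac12+it)|^2\,dt-T\left(\log\Bigl(\frac{T}{2\pi}\Bigr)+2\gamma-1\right),$$ and for $t>0$ put $$E^*(t)=E(t)-2\pi\Delta^*\Bigl(\frac{t}{2\pi}\Bigr).$$ The symbol $\ll_\varepsilon$ means that the implied constant depends only on $\varepsilon$ (and on the fixed $k$ and $c(k)$). *)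

theory Defs
  imports "HOL-Complex_Analysis.Complex_Analysis"
begin

section \<open>The Riemann zeta function\<close>

text \<open>
  The function \<open>zeta\<close> is the analytic continuation of the Dirichlet series to the
  punctured plane; the value at the pole \<open>s = 1\<close> is fixed as \<open>0\<close> to make it unique.
  Lemma \<open>is_zeta_ex1\<close> below shows that this is a proper definite description.
\<close>

definition is_zeta :: "(complex \<Rightarrow> complex) \<Rightarrow> bool" where
  "is_zeta f \<longleftrightarrow> f holomorphic_on (- {1}) \<and> f 1 = 0 \<and>
     (\<forall>s. Re s > 1 \<longrightarrow> (\<lambda>n. 1 / of_nat (Suc n) powr s) sums f s)"

definition zeta :: "complex \<Rightarrow> complex" where
  "zeta = (THE f. is_zeta f)"

lemma is_zeta_unique:
  assumes "is_zeta f" "is_zeta g"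
  shows "f = g"
proof
  fix s :: complex
  show "f s = g s"
  proof (cases "s = 1")
    case True
    then show ?thesis using assms by (simp add: is_zeta_def)
  next
    case False
    show ?thesis
    proof (rule analytic_continuation_open[where f = f and g = g and s = "{s. Re s > 1}" and s' = "- {1}"])
      show "{s. Re s > 1} \<noteq> {}" by (auto intro!: exI[of _ 2])
      show "connected (- {1 :: complex})" by (rule connected_punctured_universe) simp
      show "f z = g z" if "z \<in> {s. Re s > 1}" for z
        using assms that unfolding is_zeta_def by (metis mem_Collect_eq sums_unique2)
    qed (use assms False in \<open>auto simp: is_zeta_def open_halfspace_Re_gt\<close>)
  qed
qed

text \<open>
  For existence, put \<open>a = 1 - s\<close> and sum the expansion of \<open>(n+1) powr a - n powr a\<close> in
  powers of \<open>1/n\<close> over \<open>n \<ge> 1\<close>. This expresses \<open>g s = (s - 1) * zeta s\<close>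
  through \<open>g (s + 1), \<dots>, g (s + M - 1)\<close> and the series of remainders \<open>zeta_rem M n s\<close>,
  which converges for \<open>Re s > 1 - M\<close>, so that \<open>g\<close> extends one strip at a time.
\<close>

definition zeta_rem :: "nat \<Rightarrow> nat \<Rightarrow> complex \<Rightarrow> complex" where
  "zeta_rem M n s = of_nat (Suc (Suc n)) powr (1 - s) -
     (\<Sum>j\<le>M. ((1 - s) gchoose j) * of_nat (Suc n) powr (1 - s - of_nat j))"

lemma norm_gbinomial_le:
  fixes a :: complex
  assumes "norm a \<le> K"
  shows "norm (a gchoose j) \<le> pochhammer K j / fact j"
proof -
  have "norm (pochhammer (- a) j) \<le> pochhammer K j"
  proof (induction j)
    case (Suc j)
    have "norm (- a + of_nat j) \<le> K + of_nat j"
      using norm_triangle_ineq[of "- a" "of_nat j"] assms by simp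
    then show ?case using Suc order_trans[OF norm_ge_zero Suc]
      unfolding pochhammer_Suc norm_mult by (intro mult_mono) simp_all
  qed simp
  then show ?thesis
    by (simp add: gbinomial_pochhammer norm_divide norm_mult norm_power divide_right_mono)
qed

lemma zeta_rem_bound:
  assumes "K \<ge> 0"
  obtains C where "\<And>s n. norm (1 - s) \<le> K \<Longrightarrow> n \<ge> 1 \<Longrightarrow>
    norm (zeta_rem M n s) \<le> C * real (Suc n) powr (- Re s - real M)"
proof -
  define p where "p = (\<lambda>j. pochhammer K j / fact j)"
  have p_nonneg: "p j \<ge> 0" for j
    using assms unfolding p_def pochhammer_prod by (intro divide_nonneg_pos prod_nonneg) auto
  have summ: "summable (\<lambda>j. p j * (1/2) ^ j)"
  proof -
    have "(\<lambda>j. ((-K) gchoose j) * (- 1/2) ^ j) sums (1 + (- 1/2)) powr (-K)"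
      by (rule gen_binomial_real) simp
    moreover have "((-K) gchoose j) * (- 1/2) ^ j = p j * (1/2) ^ j" for j
      by (simp add: gbinomial_pochhammer p_def mult_ac flip: power_mult_distrib)
    ultimately show ?thesis by (simp add: sums_iff)
  qed
  define C where "C = (\<Sum>j. p (j + Suc M) * (1/2) ^ j)"
  have summ': "summable (\<lambda>j. p (j + Suc M) * (1/2) ^ j)"
  proof -
    have "summable (\<lambda>j. p (j + Suc M) * (1/2) ^ (j + Suc M) * 2 ^ Suc M)"
      by (intro summable_mult2 summable_ignore_initial_segment[OF summ])
    also have "(\<lambda>j. p (j + Suc M) * (1/2) ^ (j + Suc M) * 2 ^ Suc M) =
               (\<lambda>j. p (j + Suc M) * (1/2) ^ j)"
      by (auto simp: power_add power_divide)
    finally show ?thesis .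
  qed
  show ?thesis
  proof (rule that[of C])
    fix s :: complex and n :: nat
    assume s: "norm (1 - s) \<le> K" and n: "n \<ge> 1"
    define a where "a = 1 - s"
    define N where "N = real (Suc n)"
    define z where "z = complex_of_real (1 / N)"
    have N: "N \<ge> 2" using n by (simp add: N_def)
    have nz: "norm z = 1 / N" using N by (simp add: z_def norm_divide)
    have sums: "(\<lambda>j. (a gchoose j) * z ^ j) sums (1 + z) powr a"
      using N nz by (intro gen_binomial_complex) auto
    have tail: "(\<lambda>j. (a gchoose (j + Suc M)) * z ^ (j + Suc M)) sums
                 ((1 + z) powr a - (\<Sum>j\<le>M. (a gchoose j) * z ^ j))"
      using sums_split_initial_segment[OF sums, of "Suc M"] by (simp add: lessThan_Suc_atMost)
    have le: "norm ((a gchoose (j + Suc M)) * z ^ (j + Suc M)) \<le>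
                (p (j + Suc M) * (1/2) ^ j) * (1 / N) ^ Suc M" for j
    proof -
      have "norm ((a gchoose (j + Suc M)) * z ^ (j + Suc M)) =
              norm (a gchoose (j + Suc M)) * ((1 / N) ^ j * (1 / N) ^ Suc M)"
        by (simp only: norm_mult norm_power nz power_add)
      also have "\<dots> \<le> p (j + Suc M) * ((1 / 2) ^ j * (1 / N) ^ Suc M)"
        unfolding p_def using N s p_nonneg[of "j + Suc M"]
        by (intro mult_mono norm_gbinomial_le power_mono) (auto simp: a_def p_def)
      finally show ?thesis by (simp only: mult.assoc)
    qed
    have "norm ((1 + z) powr a - (\<Sum>j\<le>M. (a gchoose j) * z ^ j)) \<le> C * (1 / N) ^ Suc M"
      unfolding C_def sums_unique[OF tail] suminf_mult2[OF summ']
      by (intro norm_suminf_le le summable_mult2 summ')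
    moreover have "zeta_rem M n s =
        of_real N powr a * ((1 + z) powr a - (\<Sum>j\<le>M. (a gchoose j) * z ^ j))"
    proof -
      have "of_nat (Suc (Suc n)) = of_real N * (1 + z)"
      proof -
        have "complex_of_real N * (1 + z) = complex_of_real (N + 1)"
          using N by (simp add: z_def distrib_left)
        then show ?thesis by (simp add: N_def)
      qed
      moreover have "(of_real N * (1 + z)) powr a = of_real N powr a * (1 + z) powr a"
        using N by (intro powr_times_real) (auto simp: z_def)
      moreover have "of_nat (Suc n) powr (a - of_nat j) = of_real N powr a * z ^ j" for j
        by (simp add: powr_diff z_def N_def power_divide del: of_nat_Suc)
      ultimately show ?thesis
        unfolding zeta_rem_def a_def[symmetric]
        by (simp add: right_diff_distrib sum_distrib_left mult_ac del: of_nat_Suc)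
    qed
    ultimately have "norm (zeta_rem M n s) \<le> N powr Re a * (C * (1 / N) ^ Suc M)"
      using N by (simp add: norm_mult norm_powr_real_powr mult_left_mono del: power_Suc)
    also have "\<dots> = C * N powr (- Re s - real M)"
    proof -
      have "(1 / N) ^ Suc M = N powr (- real (Suc M))"
        using N by (simp only: powr_minus_divide powr_realpow power_one_over)
      then have "N powr Re a * (1 / N) ^ Suc M = N powr (Re a + - real (Suc M))"
        by (simp only: powr_add)
      also have "Re a + - real (Suc M) = - Re s - real M"
        by (simp add: a_def)
      finally show ?thesis by (simp only: mult.left_commute)
    qed
    finally show "norm (zeta_rem M n s) \<le> C * real (Suc n) powr (- Re s - real M)"
      by (simp add: N_def)
  qed
qed

lemma zeta_rem_suminf_holomorphic:
  "(\<lambda>s. \<Sum>n. zeta_rem M n s) holomorphic_on {s. Re s > 1 - real M}" (is "_ holomorphic_on ?S")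
proof (rule holomorphic_uniform_sequence)
  show S: "open ?S" by (rule open_halfspace_Re_gt)
  show "(\<lambda>s. \<Sum>i<n. zeta_rem M i s) holomorphic_on ?S" for n
    unfolding zeta_rem_def gbinomial_pochhammer pochhammer_prod
    by (intro holomorphic_intros) auto
  fix s0 :: complex assume "s0 \<in> ?S"
  define d where "d = (Re s0 - (1 - real M)) / 2"
  have d: "d > 0" "Re s0 - d > 1 - real M"
    using \<open>s0 \<in> ?S\<close> by (auto simp: d_def field_simps)
  have re: "Re s \<ge> Re s0 - d" if "s \<in> cball s0 d" for s
    using abs_Re_le_cmod[of "s0 - s"] that by (auto simp: dist_norm)
  have "cball s0 d \<subseteq> ?S" using re d by force
  obtain C where C: "\<And>s n. norm (1 - s) \<le> norm (1 - s0) + d \<Longrightarrow> n \<ge> 1 \<Longrightarrow>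
    norm (zeta_rem M n s) \<le> C * real (Suc n) powr (- Re s - real M)"
    using zeta_rem_bound[of "norm (1 - s0) + d" M] d by auto
  have "uniform_limit (cball s0 d) (\<lambda>n s. \<Sum>i<n. zeta_rem M i s) (\<lambda>s. \<Sum>n. zeta_rem M n s) sequentially"
  proof (rule Weierstrass_m_test_ev)
    show "\<forall>\<^sub>F n in sequentially. \<forall>s\<in>cball s0 d.
            norm (zeta_rem M n s) \<le> \<bar>C\<bar> * real (Suc n) powr (- (Re s0 - d) - real M)"
      using eventually_ge_at_top[of 1]
    proof eventually_elim
      case (elim n)
      show ?case
      proof
        fix s assume s: "s \<in> cball s0 d"
        have "norm (1 - s) \<le> norm (1 - s0) + d"
          using norm_triangle_ineq[of "1 - s0" "s0 - s"] s by (simp add: dist_norm)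
        from C[OF this elim] have "norm (zeta_rem M n s) \<le> C * real (Suc n) powr (- Re s - real M)" .
        also have "\<dots> \<le> \<bar>C\<bar> * real (Suc n) powr (- (Re s0 - d) - real M)"
          using re[OF s] by (intro mult_mono powr_mono) auto
        finally show "norm (zeta_rem M n s) \<le> \<bar>C\<bar> * real (Suc n) powr (- (Re s0 - d) - real M)" .
      qed
    qed
    have "summable (\<lambda>n. real n powr (- (Re s0 - d) - real M))"
      using d by (subst summable_real_powr_iff) simp
    then have "summable (\<lambda>n. real (Suc n) powr (- (Re s0 - d) - real M))"
      by (subst summable_Suc_iff)
    then show "summable (\<lambda>n. \<bar>C\<bar> * real (Suc n) powr (- (Re s0 - d) - real M))"
      by (rule summable_mult)
  qed
  with d \<open>cball s0 d \<subseteq> ?S\<close>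
  show "\<exists>d>0. cball s0 d \<subseteq> ?S \<and> uniform_limit (cball s0 d)
          (\<lambda>n s. \<Sum>i<n. zeta_rem M i s) (\<lambda>s. \<Sum>n. zeta_rem M n s) sequentially"
    by blast
qed

definition zeta_series :: "complex \<Rightarrow> complex" where
  "zeta_series s = (\<Sum>n. 1 / of_nat (Suc n) powr s)"

lemma zeta_series_sums:
  assumes "Re s > 1"
  shows "(\<lambda>n. 1 / of_nat (Suc n) powr s) sums zeta_series s"
proof -
  have "summable (\<lambda>n. real n powr (- Re s))"
    using assms by (subst summable_real_powr_iff) simp
  then have "summable (\<lambda>n. real (Suc n) powr (- Re s))"
    by (subst summable_Suc_iff)
  moreover have "norm (1 / of_nat (Suc n) powr s) = real (Suc n) powr (- Re s)" for n
    using norm_powr_real_powr[of "of_nat (Suc n)" s]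
    by (simp add: norm_divide powr_minus_divide del: of_nat_Suc)
  ultimately have "summable (\<lambda>n. norm (1 / of_nat (Suc n) powr s))"
    by (simp only:)
  then show ?thesis
    unfolding zeta_series_def by (rule summable_sums[OF summable_norm_cancel])
qed

lemma zeta_series_recurrence:
  assumes "Re s > 1" "M \<ge> 1"
  shows "(s - 1) * zeta_series s = 1 + (\<Sum>n. zeta_rem M n s) -
    (\<Sum>i\<in>{1..<M}. ((1 - s) gchoose i) / of_nat (Suc i) *
       ((s + of_nat i - 1) * zeta_series (s + of_nat i)))"
proof -
  define a where "a = 1 - s"
  have "(\<lambda>n. of_nat (Suc n) powr a) \<longlonglongrightarrow> 0"
  proof -
    have "(\<lambda>n. real (Suc n) powr Re a) \<longlonglongrightarrow> 0"
      using assms by (intro tendsto_neg_powr filterlim_compose[OF filterlim_real_sequentially filterlim_Suc])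
         (auto simp: a_def)
    moreover have "norm (of_nat (Suc n) powr a) = real (Suc n) powr Re a" for n
      using norm_powr_real_powr[of "of_nat (Suc n)" a] by (simp del: of_nat_Suc)
    ultimately show ?thesis by (subst tendsto_norm_zero_iff[symmetric]) simp
  qed
  from telescope_sums[OF this]
  have 1: "(\<lambda>n. of_nat (Suc (Suc n)) powr a - of_nat (Suc n) powr a) sums (- 1)" by simp
  have 2: "(\<lambda>n. \<Sum>i<M. (a gchoose Suc i) * (1 / of_nat (Suc n) powr (s + of_nat i))) sums
             (\<Sum>i<M. (a gchoose Suc i) * zeta_series (s + of_nat i))"
    using assms by (intro sums_sum sums_mult zeta_series_sums) auto
  have rem: "zeta_rem M n s = (of_nat (Suc (Suc n)) powr a - of_nat (Suc n) powr a) -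
      (\<Sum>i<M. (a gchoose Suc i) * (1 / of_nat (Suc n) powr (s + of_nat i)))" for n
  proof -
    have "a - of_nat (Suc i) = - (s + of_nat i)" for i by (simp add: a_def)
    then have "of_nat (Suc n) powr (a - of_nat (Suc i)) = 1 / of_nat (Suc n) powr (s + of_nat i)" for i
      by (simp only: powr_minus_divide)
    then show ?thesis
      unfolding zeta_rem_def a_def[symmetric] lessThan_Suc_atMost[symmetric]
      by (subst sum.lessThan_Suc_shift) (simp del: of_nat_Suc)
  qed
  have "(\<Sum>n. zeta_rem M n s) = -1 - (\<Sum>i<M. (a gchoose Suc i) * zeta_series (s + of_nat i))"
    using sums_unique[OF sums_diff[OF 1 2]] by (simp only: rem)
  also have "(\<Sum>i<M. (a gchoose Suc i) * zeta_series (s + of_nat i)) =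
     (\<Sum>i<M. - ((a gchoose i) / of_nat (Suc i) * ((s + of_nat i - 1) * zeta_series (s + of_nat i))))"
  proof (intro sum.cong refl)
    fix i
    have "of_nat (Suc i) * (a gchoose Suc i) = (a - of_nat i) * (a gchoose i)"
      using gbinomial_mult_1[of a i] by (simp add: algebra_simps)
    then have "(a gchoose Suc i) = - ((a gchoose i) / of_nat (Suc i) * (s + of_nat i - 1))"
      by (simp add: a_def field_simps del: of_nat_Suc)
    then show "(a gchoose Suc i) * zeta_series (s + of_nat i) =
      - ((a gchoose i) / of_nat (Suc i) * ((s + of_nat i - 1) * zeta_series (s + of_nat i)))"
      by simp
  qed
  also have "{..<M} = insert 0 {1..<M}" using assms by auto
  finally show ?thesis by (simp add: a_def sum_negf)
qed

lemma zeta_strip: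
  "\<exists>G. G holomorphic_on {s. Re s > 1 - real m} \<and>
       (\<forall>s. Re s > 1 \<longrightarrow> G s = (s - 1) * zeta_series s)"
proof (induction m)
  case 0
  let ?G = "\<lambda>s. 1 + (\<Sum>n. zeta_rem 1 n s)"
  have "?G holomorphic_on {s. Re s > 1 - real 0}"
    by (intro holomorphic_intros holomorphic_on_subset[OF zeta_rem_suminf_holomorphic]) auto
  moreover have "?G s = (s - 1) * zeta_series s" if "Re s > 1" for s
    using zeta_series_recurrence[OF that, of 1] by simp
  ultimately show ?case by blast
next
  case (Suc m)
  then obtain G where G: "G holomorphic_on {s. Re s > 1 - real m}"
    "\<And>s. Re s > 1 \<Longrightarrow> G s = (s - 1) * zeta_series s" by blast
  let ?S = "{s. Re s > 1 - real (Suc m)}"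
  let ?G = "\<lambda>s. 1 + (\<Sum>n. zeta_rem (Suc m) n s) -
    (\<Sum>i\<in>{1..<Suc m}. ((1 - s) gchoose i) / of_nat (Suc i) * G (s + of_nat i))"
  have shift: "(\<lambda>s. G (s + of_nat i)) holomorphic_on ?S" if "i \<in> {1..<Suc m}" for i
  proof -
    have "(G \<circ> (\<lambda>s. s + of_nat i)) holomorphic_on ?S"
      using that by (intro holomorphic_on_compose_gen[OF _ G(1)] holomorphic_intros) auto
    then show ?thesis by (simp add: o_def)
  qed
  have "?G holomorphic_on ?S"
    unfolding gbinomial_pochhammer pochhammer_prod
    by (intro holomorphic_intros zeta_rem_suminf_holomorphic shift) (auto simp del: of_nat_Suc)
  moreover have "?G s = (s - 1) * zeta_series s" if "Re s > 1" for s
    using that by (simp add: zeta_series_recurrence[OF that, of "Suc m"] G(2) del: of_nat_Suc)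
  ultimately show ?case by blast
qed

lemma is_zeta_ex1: "\<exists>!f. is_zeta f"
proof -
  obtain G where G: "\<And>m. G m holomorphic_on {s. Re s > 1 - real m}"
    "\<And>m s. Re s > 1 \<Longrightarrow> G m s = (s - 1) * zeta_series s"
    using zeta_strip by metis
  have agree: "G m s = G n s" if "m \<le> n" "Re s > 1 - real m" for m n s
  proof (rule analytic_continuation_open[where f = "G m" and g = "G n"
        and s = "{s. Re s > 1}" and s' = "{s. Re s > 1 - real m}"])
    show "{s. Re s > 1} \<noteq> {}" by (auto intro!: exI[of _ 2])
    show "connected {s. Re s > 1 - real m}"
      by (intro convex_connected convex_halfspace_Re_gt)
    show "G n holomorphic_on {s. Re s > 1 - real m}"
      using that by (intro holomorphic_on_subset[OF G(1)]) auto
  qed (use that G in \<open>auto simp: open_halfspace_Re_gt\<close>)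
  define g where "g s = G (nat \<lceil>2 - Re s\<rceil>) s" for s
  have g_eq: "g s = G m s" if "Re s > 1 - real m" for m s
  proof -
    have "Re s > 1 - real (nat \<lceil>2 - Re s\<rceil>)" by linarith
    then show ?thesis
      unfolding g_def using agree that by (metis nat_le_linear)
  qed
  have "g holomorphic_on UNIV"
  proof (rule holomorphic_onI)
    fix s :: complex
    obtain m where m: "real m > 1 - Re s" using reals_Archimedean2 by blast
    have "g holomorphic_on {s. Re s > 1 - real m}"
      using G(1)[of m] by (rule holomorphic_transform) (auto simp: g_eq)
    then show "g field_differentiable (at s within UNIV)"
      using m by (auto simp: open_halfspace_Re_gt dest!: holomorphic_on_imp_differentiable_at)
  qed
  define f where "f s = (if s = 1 then 0 else g s / (s - 1))" for s
  have "(\<lambda>s. g s / (s - 1)) holomorphic_on (- {1})"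
    by (intro holomorphic_intros holomorphic_on_subset[OF \<open>g holomorphic_on UNIV\<close>]) auto
  then have "f holomorphic_on (- {1})"
    by (rule holomorphic_transform) (auto simp: f_def)
  moreover have "(\<lambda>n. 1 / of_nat (Suc n) powr s) sums f s" if "Re s > 1" for s
  proof -
    have "f s = zeta_series s"
      using that by (auto simp: f_def g_eq[of 0] G(2))
    then show ?thesis using zeta_series_sums[OF that] by simp
  qed
  ultimately have "is_zeta f" by (simp add: is_zeta_def f_def)
  then show ?thesis using is_zeta_unique by blast
qed

lemma is_zeta_zeta: "is_zeta zeta"
  unfolding zeta_def by (rule theI'[OF is_zeta_ex1])


section \<open>The divisor problem and the mean square of zeta\<close>

definition divisor_count :: "nat \<Rightarrow> nat" where
  "divisor_count n = card {d. d dvd n}"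

definition Delta :: "real \<Rightarrow> real" where
  "Delta x = (\<Sum>n | 1 \<le> n \<and> real n \<le> x. real (divisor_count n))
               - x * (ln x + 2 * euler_mascheroni - 1)"

definition Delta_star :: "real \<Rightarrow> real" where
  "Delta_star x = - Delta x + 2 * Delta (2 * x) - 1 / 2 * Delta (4 * x)"

definition E :: "real \<Rightarrow> real" where
  "E T = integral {0..T} (\<lambda>t. (norm (zeta (Complex (1/2) t)))\<^sup>2)
           - T * (ln (T / (2 * pi)) + 2 * euler_mascheroni - 1)"

text \<open>
  Only positive arguments are meaningful. At the left endpoint of the integrals over
  \<open>{0..T}\<close> the library convention \<open>ln 0 = 0\<close> gives a harmless value at a single point.
\<close>

definition Estar :: "real \<Rightarrow> real" where
  "Estar t = E t - 2 * pi * Delta_star (t / (2 * pi))"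

end

theory Submission
  imports Defs "HOL-Real_Asymp.Real_Asymp"
begin

text \<open>
  Write \<open>w(t) = |\<zeta>(1/2 + it)|^2\<close>, \<open>I(t)\<close> for its integral over \<open>[0, t]\<close>, and \<open>D(x)\<close> for the sum of
  \<open>d(n)\<close> over \<open>n \<le> x\<close>. In \<open>E\<^sup>*(t)\<close> the smooth main terms cancel exactly:
  \<open>E\<^sup>*(t) = I(t) - 2 \<pi> (- D(x) + 2 D(2x) - D(4x)/2)\<close> with \<open>x = t / (2 \<pi>)\<close>. So \<open>E\<^sup>*\<close> is a nondecreasing
  function minus a step function, and by the divisor bound the step function grows over an
  interval of length \<open>h \<ge> 1\<close> by at most \<open>h T^\<eta>\<close> when \<open>T\<close> is large (lemmas \<open>Estar_eq\<close>, \<open>Estar_diff_ge_powr\<close>).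

  This makes large values of \<open>I(t + L) - I(t - L)\<close> expensive. If the increment \<open>X\<close> of \<open>I\<close> over an
  interval of length comparable to \<open>L\<close> exceeds \<open>L T^(4 \<eta>)\<close>, the step function cannot compensate it
  even over a slightly longer interval. Then \<open>E\<^sup>*\<close> is at least \<open>X/4\<close> in absolute value at one point of
  every pair \<open>u\<close>, \<open>u + 4L\<close> with \<open>u\<close> to the left of the interval and \<open>u + 4L\<close> to its right, and the
  integral of \<open>|E\<^sup>*|^k\<close> nearby is at least \<open>L (X/4)^k\<close> (lemma \<open>integral_Estar_powr_ge\<close>).

  To use this, \<open>w(t)\<close> is bounded by \<open>T^\<eta> (1 + J)\<close>, where \<open>J\<close> is the increment of \<open>I\<close> over
  \<open>[t - T^\<eta>, t + T^\<eta>]\<close> (lemma \<open>zeta_sq_le_local_mean\<close>). Where \<open>J\<close> is a bounded power of \<open>T^\<eta>\<close>, the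
  contribution to the integral of \<open>w^(k+1)\<close> is \<open>T^(1 + \<epsilon>)\<close>. Elsewhere let \<open>L\<close> be the power of \<open>T^\<eta>\<close> for
  which \<open>J\<close> lies between \<open>L T^(4 \<eta>)\<close> and \<open>L T^(5 \<eta>)\<close>. Then \<open>w^(k+1)\<close> is at most \<open>w J^(k-1) L\<close> up to a
  power of \<open>T^\<eta>\<close>, and the integral of that over a block of length \<open>L\<close> is at most
  \<open>L X^k\<close>, which is paid for by \<open>|E\<^sup>*|^k\<close>. This is where the exponent \<open>2k + 2\<close> comes from: one factor
  \<open>w\<close> is traded for the length of the interval on which \<open>E\<^sup>*\<close> stays large. With \<open>\<eta> = 1/N\<close> there are
  fewer than \<open>N\<close> scales \<open>L\<close>.

  The term \<open>T^(1 + \<epsilon>)\<close> is harmless because \<open>c \<ge> 1\<close>: at every odd \<open>n = 2t/\<pi>\<close> the function \<open>E\<^sup>*\<close>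
  jumps by \<open>\<pi> d(n)\<close>, so it cannot be small on both sides of such a point
  (lemma \<open>integral_Estar_powr_ge_linear\<close>).
\<close>

section \<open>The divisor bound\<close>

lemma divisor_count_mult_le:
  assumes "a > 0" "b > 0"
  shows "divisor_count (a * b) \<le> divisor_count a * divisor_count b"
proof -
  have "{d. d dvd a * b} \<subseteq> (\<lambda>(x, y). x * y) ` ({x. x dvd a} \<times> {y. y dvd b})"
  proof
    fix d assume "d \<in> {d. d dvd a * b}"
    then obtain x y where "d = x * y" "x dvd a" "y dvd b"
      using division_decomp[of d a b] by auto
    then show "d \<in> (\<lambda>(x, y). x * y) ` ({x. x dvd a} \<times> {y. y dvd b})"
      by (intro image_eqI[where x = "(x, y)"]) simp_all
  qed
  moreover have "finite ({x. x dvd a} \<times> {y. y dvd b})"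
    using assms by (intro finite_cartesian_product finite_divisors_nat) auto
  ultimately have "card {d. d dvd a * b} \<le> card ({x. x dvd a} \<times> {y. y dvd b})"
    by (rule surj_card_le[rotated])
  then show ?thesis by (simp add: divisor_count_def card_cartesian_product)
qed

lemma divisor_count_prime_power_le:
  assumes "prime p"
  shows "divisor_count (p ^ e) \<le> Suc e"
proof -
  have "{d. d dvd p ^ e} \<subseteq> (\<lambda>i. p ^ i) ` {..e}"
    using assms by (auto simp: divides_primepow_nat)
  then have "card {d. d dvd p ^ e} \<le> card {..e}" by (rule surj_card_le[rotated]) simp
  then show ?thesis by (simp add: divisor_count_def)
qed

text \<open>
  A prime factor \<open>p \<ge> K\<close> at most doubles the number of divisors, and \<open>2 \<le> p powr \<epsilon>\<close>, so numbers
  without small prime factors satisfy the bound with constant 1.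
\<close>

lemma divisor_count_le_powr_rough:
  fixes \<epsilon> :: real
  assumes "\<epsilon> > 0" "real K powr \<epsilon> \<ge> 2" "n > 0" "\<And>p. prime p \<Longrightarrow> p dvd n \<Longrightarrow> p \<ge> K"
  shows "real (divisor_count n) \<le> real n powr \<epsilon>"
  using assms(3,4)
proof (induction n rule: less_induct)
  case (less n)
  show ?case
  proof (cases "n = 1")
    case True
    then show ?thesis by (simp add: divisor_count_def)
  next
    case False
    then obtain p where p: "prime p" "p dvd n" using prime_factor_nat by blast
    then obtain m where m: "n = p * m" by auto
    then have m0: "m > 0" "m < n" using less.prems p(1) prime_gt_1_nat by auto
    have "real (divisor_count m) \<le> real m powr \<epsilon>"
      using less.prems m by (intro less.IH m0) auto
    moreover have "divisor_count n \<le> 2 * divisor_count m"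
    proof -
      have "divisor_count n \<le> divisor_count p * divisor_count m"
        unfolding m using p(1) m0 prime_gt_0_nat[of p] by (intro divisor_count_mult_le) auto
      also have "\<dots> \<le> 2 * divisor_count m"
        using divisor_count_prime_power_le[OF p(1), of 1] by (intro mult_right_mono) auto
      finally show ?thesis .
    qed
    moreover have "2 \<le> real p powr \<epsilon>"
    proof -
      have "real K powr \<epsilon> \<le> real p powr \<epsilon>"
        using less.prems(2)[OF p] assms(1) by (intro powr_mono2) auto
      with assms(2) show ?thesis by linarith
    qed
    ultimately have "real (2 * divisor_count m) \<le> real p powr \<epsilon> * real m powr \<epsilon>"
      and "real (divisor_count n) \<le> real (2 * divisor_count m)"
      by (auto intro!: mult_mono simp del: of_nat_mult simp add: of_nat_mult)
    then have "real (divisor_count n) \<le> real p powr \<epsilon> * real m powr \<epsilon>" by linarith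
    then show ?thesis using m by (simp add: powr_mult)
  qed
qed

lemma Suc_le_const_mult_powr:
  fixes \<epsilon> :: real
  assumes "\<epsilon> > 0"
  obtains C where "C \<ge> 1" "\<And>e. real (Suc e) \<le> C * (2 powr \<epsilon>) ^ e"
proof -
  have "(\<lambda>e. real e / (2 powr \<epsilon>) ^ e) \<longlonglongrightarrow> 0"
    using assms by (intro lim_n_over_pown) auto
  then have "Bseq (\<lambda>e. real e / (2 powr \<epsilon>) ^ e)"
    using convergent_def convergent_imp_Bseq by blast
  then obtain B where B: "\<And>e. norm (real e / (2 powr \<epsilon>) ^ e) \<le> B"
    by (auto simp: Bseq_def)
  have "real (Suc e) \<le> (B + 1) * (2 powr \<epsilon>) ^ e" for e
  proof -
    have "real e \<le> B * (2 powr \<epsilon>) ^ e" using B[of e] by (simp add: field_simps)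
    moreover have "1 \<le> (2 powr \<epsilon>) ^ e" using assms by (intro one_le_power ge_one_powr_ge_zero) auto
    ultimately show ?thesis by (simp add: algebra_simps)
  qed
  moreover have "B + 1 \<ge> 1" using B[of 0] by simp
  ultimately show ?thesis using that by blast
qed

text \<open>
  Admitting one more small prime \<open>K\<close> costs a constant factor: its power \<open>K ^ e\<close> contributes at
  most \<open>e + 1\<close> divisors, which is dominated by \<open>(K ^ e) powr \<epsilon>\<close>.
\<close>

lemma divisor_count_le_powr_rough_descend:
  fixes \<epsilon> :: real
  assumes "\<epsilon> > 0"
    and C: "C \<ge> 0" "\<And>n. n > 0 \<Longrightarrow> (\<And>p. prime p \<Longrightarrow> p dvd n \<Longrightarrow> p \<ge> Suc K) \<Longrightarrow>
          real (divisor_count n) \<le> C * real n powr \<epsilon>"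
    and B: "B \<ge> 1" "\<And>e. real (Suc e) \<le> B * (2 powr \<epsilon>) ^ e"
    and n: "n > 0" "\<And>p. prime p \<Longrightarrow> p dvd n \<Longrightarrow> p \<ge> K"
  shows "real (divisor_count n) \<le> B * C * real n powr \<epsilon>"
proof (cases "prime K")
  case False
  then have "\<And>p. prime p \<Longrightarrow> p dvd n \<Longrightarrow> p \<ge> Suc K"
    using n by (metis le_antisym not_less_eq_eq)
  then have "real (divisor_count n) \<le> C * real n powr \<epsilon>" using C n by blast
  also have "\<dots> \<le> B * C * real n powr \<epsilon>" using B C by (intro mult_right_mono) (auto simp: mult_le_cancel_right1)
  finally show ?thesis .
next
  case True
  obtain m e where m: "n = K ^ e * m" "\<not> K dvd m"
    using multiplicity_decompose'[of n K] True n by (metis not_gr_zero not_prime_unit)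
  have m0: "m > 0" using m n by (auto intro: Nat.gr0I)
  have "p \<ge> Suc K" if "prime p" "p dvd m" for p
    using that m n(2)[of p] by (metis dvd_mult le_antisym not_less_eq_eq)
  then have 1: "real (divisor_count m) \<le> C * real m powr \<epsilon>" using C m0 by blast
  have "real (divisor_count (K ^ e)) \<le> real (Suc e)"
    using divisor_count_prime_power_le[OF True, of e] by linarith
  also have "\<dots> \<le> B * (2 powr \<epsilon>) ^ e" by (rule B)
  also have "(2 powr \<epsilon>) ^ e \<le> (real K powr \<epsilon>) ^ e"
    using prime_ge_2_nat[OF True] assms(1) by (intro power_mono powr_mono2) auto
  also have "(real K powr \<epsilon>) ^ e = real (K ^ e) powr \<epsilon>"
    using prime_gt_0_nat[OF True] by (simp add: powr_powr flip: powr_realpow) (simp add: mult.commute)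
  finally have 2: "real (divisor_count (K ^ e)) \<le> B * real (K ^ e) powr \<epsilon>"
    using B(1) by (simp add: mult_left_mono)
  have "real (divisor_count n) \<le> real (divisor_count (K ^ e)) * real (divisor_count m)"
    unfolding m(1) using divisor_count_mult_le[of "K ^ e" m] m0 prime_gt_0_nat[OF True]
    by (metis of_nat_mono of_nat_mult zero_less_power)
  also have "\<dots> \<le> (B * real (K ^ e) powr \<epsilon>) * (C * real m powr \<epsilon>)"
    using 1 2 B C by (intro mult_mono) auto
  also have "\<dots> = B * C * real n powr \<epsilon>" unfolding m(1) by (simp add: powr_mult)
  finally show ?thesis .
qed

text \<open>
  Starting from a threshold \<open>K\<close> with \<open>K powr \<epsilon> \<ge> 2\<close>, the finitely many primes below \<open>K\<close> are admitted
  one at a time.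
\<close>

lemma divisor_count_bound:
  fixes \<epsilon> :: real
  assumes "\<epsilon> > 0"
  obtains C where "C > 0" "\<And>n. n > 0 \<Longrightarrow> real (divisor_count n) \<le> C * real n powr \<epsilon>"
proof -
  obtain B where B: "B \<ge> 1" "\<And>e. real (Suc e) \<le> B * (2 powr \<epsilon>) ^ e"
    using Suc_le_const_mult_powr[OF assms] by blast
  define K where "K = nat \<lceil>2 powr (1 / \<epsilon>)\<rceil>"
  have "(2 powr (1 / \<epsilon>)) powr \<epsilon> \<le> real K powr \<epsilon>"
    unfolding K_def using assms by (intro powr_mono2) (auto simp: real_nat_ceiling_ge)
  then have K: "real K powr \<epsilon> \<ge> 2" using assms by (simp add: powr_powr)
  have "\<forall>n>0. (\<forall>p. prime p \<longrightarrow> p dvd n \<longrightarrow> p \<ge> K - j) \<longrightarrow>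
           real (divisor_count n) \<le> B ^ j * real n powr \<epsilon>" for j
  proof (induction j)
    case 0
    then show ?case using divisor_count_le_powr_rough[OF assms K] by simp
  next
    case (Suc j)
    show ?case
    proof (cases "j < K")
      case True
      then have eq: "K - j = Suc (K - Suc j)" by simp
      show ?thesis unfolding power_Suc
        using Suc.IH B unfolding eq
        by (intro allI impI divisor_count_le_powr_rough_descend[OF assms _ _ B, where K = "K - Suc j"]) auto
    next
      case False
      show ?thesis
      proof (intro allI impI)
        fix n :: nat assume n: "n > 0"
        have "real (divisor_count n) \<le> B ^ j * real n powr \<epsilon>" using Suc.IH False n by simp
        also have "\<dots> \<le> B ^ Suc j * real n powr \<epsilon>"
          using B(1) by (intro mult_right_mono) auto
        finally show "real (divisor_count n) \<le> B ^ Suc j * real n powr \<epsilon>" .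
      qed
    qed
  qed
  from this[of K] show ?thesis using B(1) by (intro that[of "B ^ K"]) auto
qed

section \<open>The error term without its logarithms\<close>

definition zeta_sq :: "real \<Rightarrow> real" where
  "zeta_sq t = (norm (zeta (Complex (1/2) t)))\<^sup>2"

definition mean_sq :: "real \<Rightarrow> real" where
  "mean_sq T = integral {0..T} zeta_sq"

definition divisor_sum :: "real \<Rightarrow> real" where
  "divisor_sum x = (\<Sum>n | 1 \<le> n \<and> real n \<le> x. real (divisor_count n))"

text \<open>
  The combination that defines \<open>2 \<pi> \<Delta>\<^sup>*(t / (2 \<pi>))\<close>, with \<open>\<Delta>\<close> replaced by the divisor sum.
\<close>

definition divisor_step :: "real \<Rightarrow> real" where
  "divisor_step t = 2 * pi * (- divisor_sum (t / (2 * pi)) + 2 * divisor_sum (t / pi)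
     - divisor_sum (2 * t / pi) / 2)"

lemma zeta_sq_nonneg: "zeta_sq t \<ge> 0"
  by (simp add: zeta_sq_def)

lemma zeta_holomorphic: "zeta holomorphic_on - {1}"
  using is_zeta_zeta by (simp add: is_zeta_def)

lemma continuous_on_zeta_vertical:
  assumes "x \<noteq> 1"
  shows "continuous_on A (\<lambda>t. zeta (Complex x t))"
proof -
  have "continuous_on (- {1}) zeta"
    by (rule holomorphic_on_imp_continuous_on[OF zeta_holomorphic])
  then have "continuous_on UNIV (\<lambda>t. zeta (Complex x t))"
    by (rule continuous_on_compose2) (use assms in \<open>auto intro!: continuous_intros simp: complex_eq_iff\<close>)
  then show ?thesis by (rule continuous_on_subset) simp
qed

lemma continuous_on_zeta_sq: "continuous_on A zeta_sq"
  unfolding zeta_sq_def by (intro continuous_intros continuous_on_zeta_vertical) auto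

lemma zeta_sq_integrable: "zeta_sq integrable_on {a..b}"
  by (intro integrable_continuous_interval continuous_on_zeta_sq)

lemma mean_sq_diff:
  assumes "0 \<le> a" "a \<le> b"
  shows "mean_sq b - mean_sq a = integral {a..b} zeta_sq"
  using Henstock_Kurzweil_Integration.integral_combine[OF assms zeta_sq_integrable]
  by (simp add: mean_sq_def)

lemma mean_sq_neg: "T \<le> 0 \<Longrightarrow> mean_sq T = 0"
  by (cases "T = 0") (simp_all add: mean_sq_def)

lemma mean_sq_mono:
  assumes "a \<le> b"
  shows "mean_sq a \<le> mean_sq b"
proof -
  have *: "mean_sq a \<le> mean_sq b" if "0 \<le> a" "a \<le> b" for a b
    using mean_sq_diff[OF that] integral_nonneg[OF zeta_sq_integrable, of a b] zeta_sq_nonneg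
    by simp
  show ?thesis
    using *[of a b] *[of 0 b] assms by (cases "0 \<le> a"; cases "0 \<le> b") (auto simp: mean_sq_neg)
qed

lemma mean_sq_nonneg: "mean_sq t \<ge> 0"
  using mean_sq_mono[of 0 t] mean_sq_neg[of 0] mean_sq_neg[of t] by (cases "t \<ge> 0") auto

lemma borel_measurable_mean_sq [measurable]: "mean_sq \<in> borel_measurable borel"
  by (intro borel_measurable_mono monoI mean_sq_mono)

lemma borel_measurable_zeta_sq [measurable]: "zeta_sq \<in> borel_measurable borel"
  by (intro borel_measurable_continuous_onI continuous_on_zeta_sq)

lemma finite_nat_le_real: "finite {n. 1 \<le> n \<and> real n \<le> x}"
proof (rule finite_subset)
  show "{n. 1 \<le> n \<and> real n \<le> x} \<subseteq> {..nat \<lfloor>x\<rfloor>}" by (auto simp: le_nat_floor)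
qed simp

lemma divisor_sum_mono: "x \<le> y \<Longrightarrow> divisor_sum x \<le> divisor_sum y"
  unfolding divisor_sum_def by (intro sum_mono2 finite_nat_le_real) auto

text \<open>
  With \<open>g(x) = x (ln x + 2 \<gamma> - 1)\<close> one has \<open>g(x) - 2 g(2x) + g(4x)/2 = - g(x)\<close>, because
  \<open>1 - 4 + 2 = -1\<close> and the contributions \<open>4x ln 2\<close> of the last two terms cancel. So the smooth part of
  \<open>2 \<pi> \<Delta>\<^sup>*(t / (2 \<pi>))\<close> is \<open>- 2 \<pi> g(t / (2 \<pi>))\<close>, which is also the term that \<open>E\<close> adds to the mean square.
\<close>

lemma Estar_eq:
  assumes "t \<ge> 0"
  shows "Estar t = mean_sq t - divisor_step t"
proof (cases "t = 0")
  case True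
  have "{n. 1 \<le> n \<and> real n \<le> 0} = {}" by auto
  then show ?thesis unfolding True
    by (simp add: Estar_def E_def mean_sq_def divisor_step_def Delta_star_def Delta_def divisor_sum_def)
next
  case False
  define x where "x = t / (2 * pi)"
  have x: "x > 0" "t = 2 * pi * x" using assms False by (auto simp: x_def)
  have D: "Delta y = divisor_sum y - y * (ln y + 2 * euler_mascheroni - 1)" for y
    by (simp add: Delta_def divisor_sum_def)
  have ln: "ln (2 * x) = ln 2 + ln x" "ln (4 * x) = 2 * ln 2 + ln x"
    using x ln_mult[of 4 x] ln_mult[of 2 x] ln_realpow[of 2 2] by simp_all
  have "t / pi = 2 * x" "2 * t / pi = 4 * x" by (simp_all add: x_def)
  moreover have "Estar t = mean_sq t - 2 * pi * x * (ln x + 2 * euler_mascheroni - 1)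
      - 2 * pi * Delta_star x"
    using x by (simp add: Estar_def E_def mean_sq_def zeta_sq_def[abs_def])
  moreover have "Delta_star x = (- divisor_sum x + 2 * divisor_sum (2 * x) - divisor_sum (4 * x) / 2)
      - x * (ln x + 2 * euler_mascheroni - 1)"
    unfolding Delta_star_def D ln by (simp add: algebra_simps)
  ultimately show ?thesis
    unfolding divisor_step_def x_def[symmetric] by (simp only:) (simp add: algebra_simps)
qed

lemma divisor_sum_diff_le:
  assumes "0 \<le> x" "x \<le> y" "\<And>n. 1 \<le> n \<Longrightarrow> real n \<le> y \<Longrightarrow> real (divisor_count n) \<le> B" "B \<ge> 0"
  shows "divisor_sum y - divisor_sum x \<le> B * (y - x + 1)"
proof -
  let ?S = "\<lambda>x. {n. 1 \<le> n \<and> real n \<le> x}"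
  have "?S x \<subseteq> ?S y" using assms by auto
  then have "divisor_sum y - divisor_sum x = (\<Sum>n\<in>?S y - ?S x. real (divisor_count n))"
    unfolding divisor_sum_def by (subst sum_diff[OF finite_nat_le_real]) auto
  also have "\<dots> \<le> (\<Sum>n\<in>?S y - ?S x. B)" using assms by (intro sum_mono) auto
  also have "\<dots> = B * real (card (?S y - ?S x))" by simp
  also have "real (card (?S y - ?S x)) \<le> y - x + 1"
  proof -
    have "?S y - ?S x \<subseteq> {nat \<lfloor>x\<rfloor> + 1..nat \<lfloor>y\<rfloor>}"
      by (auto simp: le_nat_floor) linarith
    then have "card (?S y - ?S x) \<le> card {nat \<lfloor>x\<rfloor> + 1..nat \<lfloor>y\<rfloor>}" by (intro card_mono) auto
    then have "card (?S y - ?S x) \<le> nat \<lfloor>y\<rfloor> - nat \<lfloor>x\<rfloor>" by simp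
    then show ?thesis using assms(1,2) by linarith
  qed
  finally show ?thesis using assms(4) by (simp add: mult_left_mono)
qed

text \<open>
  The terms \<open>- D(x)\<close> and \<open>- D(4x)/2\<close> are nonincreasing, so the growth of the step function is
  controlled by \<open>2 D(2x)\<close>.
\<close>

lemma divisor_step_diff_le:
  assumes "0 \<le> u" "u \<le> v" "\<And>n. 1 \<le> n \<Longrightarrow> real n \<le> v \<Longrightarrow> real (divisor_count n) \<le> B" "B \<ge> 0"
  shows "divisor_step v - divisor_step u \<le> 4 * B * (v - u + pi)"
proof -
  have "divisor_sum (v / pi) - divisor_sum (u / pi) \<le> B * (v / pi - u / pi + 1)"
  proof (rule divisor_sum_diff_le)
    fix n :: nat assume "1 \<le> n" "real n \<le> v / pi"
    moreover have "v / pi \<le> v" using assms(1,2) pi_gt3 by (simp add: divide_le_eq mult_le_cancel_left1)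
    ultimately show "real (divisor_count n) \<le> B" using assms(3) by simp
  qed (use assms in \<open>auto simp: divide_right_mono\<close>)
  moreover have "divisor_sum (u / (2 * pi)) \<le> divisor_sum (v / (2 * pi))"
    "divisor_sum (2 * u / pi) \<le> divisor_sum (2 * v / pi)"
    using assms(2) by (intro divisor_sum_mono divide_right_mono; simp)+
  ultimately have "2 * pi * (- divisor_sum (v / (2 * pi)) + 2 * divisor_sum (v / pi) - divisor_sum (2 * v / pi) / 2
     - (- divisor_sum (u / (2 * pi)) + 2 * divisor_sum (u / pi) - divisor_sum (2 * u / pi) / 2))
     \<le> 2 * pi * (2 * (B * (v / pi - u / pi + 1)))"
    by (intro mult_left_mono) auto
  also have "\<dots> = 4 * B * (v - u + pi)" by (simp add: field_simps)
  finally show ?thesis by (simp add: divisor_step_def right_diff_distrib)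
qed

lemma Estar_diff_ge:
  assumes "0 \<le> u" "u \<le> v" "\<And>n. 1 \<le> n \<Longrightarrow> real n \<le> v \<Longrightarrow> real (divisor_count n) \<le> B" "B \<ge> 0"
  shows "Estar v - Estar u \<ge> mean_sq v - mean_sq u - 4 * B * (v - u + pi)"
  using divisor_step_diff_le[OF assms] Estar_eq[of u] Estar_eq[of v] assms(1,2) by simp

lemma integrable_on_bounded_borel:
  fixes f :: "real \<Rightarrow> real"
  assumes "f \<in> borel_measurable borel" "\<And>x. x \<in> {a..b} \<Longrightarrow> \<bar>f x\<bar> \<le> B"
  shows "f integrable_on {a..b}"
proof (rule measurable_bounded_by_integrable_imp_integrable_real)
  show "f \<in> borel_measurable (lebesgue_on {a..b})"
    using assms(1) by (intro measurable_restrict_space1) (simp add: measurable_completion)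
  show "(\<lambda>x. B) integrable_on {a..b}" by (rule integrable_const_ivl)
qed (use assms in auto)

lemma borel_measurable_divisor_sum [measurable]: "divisor_sum \<in> borel_measurable borel"
  by (intro borel_measurable_mono monoI divisor_sum_mono)

lemma borel_measurable_divisor_step [measurable]: "divisor_step \<in> borel_measurable borel"
  unfolding divisor_step_def by measurable

lemma Estar_powr_integrable:
  assumes "0 \<le> a" "k \<ge> 0"
  shows "(\<lambda>t. \<bar>Estar t\<bar> powr k) integrable_on {a..b}"
proof (cases "a \<le> b")
  case False
  then show ?thesis by (simp add: integrable_on_empty)
next
  case True
  define B where "B = mean_sq b + (2 * pi * (divisor_sum (b / (2 * pi)) + 2 * divisor_sum (b / pi)
     + divisor_sum (2 * b / pi) / 2))"
  have "(\<lambda>t. \<bar>mean_sq t - divisor_step t\<bar> powr k) integrable_on {a..b}"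
  proof (rule integrable_on_bounded_borel)
    show "(\<lambda>t. \<bar>mean_sq t - divisor_step t\<bar> powr k) \<in> borel_measurable borel" by measurable
    fix t assume t: "t \<in> {a..b}"
    have nn: "divisor_sum x \<ge> 0" for x unfolding divisor_sum_def by (intro sum_nonneg) auto
    have le: "divisor_sum (t / (2 * pi)) \<le> divisor_sum (b / (2 * pi))"
       "divisor_sum (t / pi) \<le> divisor_sum (b / pi)"
       "divisor_sum (2 * t / pi) \<le> divisor_sum (2 * b / pi)"
      using t by (intro divisor_sum_mono divide_right_mono; simp)+
    have "\<bar>divisor_step t\<bar> = 2 * pi * \<bar>- divisor_sum (t / (2 * pi)) + 2 * divisor_sum (t / pi)
       - divisor_sum (2 * t / pi) / 2\<bar>" by (simp add: divisor_step_def abs_mult)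
    also have "\<dots> \<le> 2 * pi * (divisor_sum (b / (2 * pi)) + 2 * divisor_sum (b / pi)
     + divisor_sum (2 * b / pi) / 2)"
      using le nn[of "t / (2 * pi)"] nn[of "t / pi"] nn[of "2 * t / pi"]
      by (intro mult_left_mono) (auto simp: abs_le_iff)
    finally have "\<bar>divisor_step t\<bar> \<le> B - mean_sq b" by (simp add: B_def)
    moreover have "0 \<le> mean_sq t" "mean_sq t \<le> mean_sq b"
      using t by (auto intro: mean_sq_mono mean_sq_nonneg)
    ultimately have "\<bar>mean_sq t - divisor_step t\<bar> \<le> B" by linarith
    then show "\<bar>\<bar>mean_sq t - divisor_step t\<bar> powr k\<bar> \<le> B powr k"
      using assms(2) by (simp add: powr_mono2)
  qed
  moreover have "\<bar>mean_sq t - divisor_step t\<bar> powr k = \<bar>Estar t\<bar> powr k" if "t \<in> {a..b}" for t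
    using that assms by (simp add: Estar_eq)
  ultimately show ?thesis using integrable_eq by (metis (no_types, lifting))
qed

section \<open>Moments of the error term from below\<close>

lemma integral_Estar_powr_nonneg: "integral {a..b} (\<lambda>t. \<bar>Estar t\<bar> powr k) \<ge> 0"
  by (cases "(\<lambda>t. \<bar>Estar t\<bar> powr k) integrable_on {a..b}")
     (auto intro: integral_nonneg simp: not_integrable_integral)

lemma integral_Estar_powr_subset:
  assumes "k \<ge> 0" "0 \<le> a" "a \<le> c" "d \<le> b"
  shows "integral {c..d} (\<lambda>t. \<bar>Estar t\<bar> powr k) \<le> integral {a..b} (\<lambda>t. \<bar>Estar t\<bar> powr k)"
  using assms by (intro integral_subset_le Estar_powr_integrable) auto

text \<open>
  If \<open>E\<^sup>*\<close> rises by \<open>Y\<close> between \<open>u\<close> and \<open>u + h\<close>, then \<open>|E\<^sup>*| \<ge> Y/2\<close> at one of the two points. The bound is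
  the integral of this over the pairs; the condition \<open>q \<le> p + h\<close> keeps the left and right points apart.
\<close>

lemma integral_Estar_powr_ge:
  assumes k: "k \<ge> 0" and pq: "0 \<le> p" "p \<le> q" "q \<le> p + h" and Y: "Y \<ge> 0"
    and jump: "\<And>u. p \<le> u \<Longrightarrow> u < q \<Longrightarrow> Estar (u + h) - Estar u \<ge> Y"
  shows "integral {p..q + h} (\<lambda>t. \<bar>Estar t\<bar> powr k) \<ge> (q - p) * (Y / 2) powr k"
proof -
  let ?f = "\<lambda>t. \<bar>Estar t\<bar> powr k"
  have h: "h \<ge> 0" using pq by simp
  have int: "?f integrable_on {a..b}" if "a \<ge> 0" for a b
    using that k by (intro Estar_powr_integrable)
  have shift: "(\<lambda>u. ?f (u + h)) integrable_on {p..q}"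
    "integral {p..q} (\<lambda>u. ?f (u + h)) = integral {p + h..q + h} ?f"
  proof -
    have "((\<lambda>u. ?f (u + h)) has_integral integral {p + h..q + h} ?f) {p..q}"
      using has_integral_shift_Icc_real[of ?f h "integral {p + h..q + h} ?f" p q]
        integrable_integral[OF int[of "p + h" "q + h"]] pq h by (simp add: o_def add.commute)
    then show "(\<lambda>u. ?f (u + h)) integrable_on {p..q}"
     "integral {p..q} (\<lambda>u. ?f (u + h)) = integral {p + h..q + h} ?f"
      by (auto simp: has_integral_iff)
  qed
  have "(q - p) * (Y / 2) powr k = integral {p..q} (\<lambda>u. if u = q then 0 else (Y / 2) powr k)"
  proof -
    have "integral {p..q} (\<lambda>u. if u = q then 0 else (Y / 2) powr k) = integral {p..q} (\<lambda>u. (Y / 2) powr k)"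
      by (rule integral_spike[of "{q}"]) auto
    then show ?thesis using pq by simp
  qed
  also have "\<dots> \<le> integral {p..q} (\<lambda>u. ?f u + ?f (u + h))"
  proof (rule integral_le)
    show "(\<lambda>u. if u = q then 0 else (Y / 2) powr k) integrable_on {p..q}"
      by (rule integrable_spike[of "\<lambda>u. (Y / 2) powr k" _ "{q}"]) (auto simp: integrable_const_ivl)
    show "(\<lambda>u. ?f u + ?f (u + h)) integrable_on {p..q}"
      using pq by (intro integrable_add int shift)
    fix u assume u: "u \<in> {p..q}"
    show "(if u = q then 0 else (Y / 2) powr k) \<le> ?f u + ?f (u + h)"
    proof (cases "u = q")
      case False
      then have "Estar (u + h) - Estar u \<ge> Y" using jump u by auto
      then have "Y / 2 \<le> \<bar>Estar u\<bar> \<or> Y / 2 \<le> \<bar>Estar (u + h)\<bar>" by linarith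
      then have "(Y / 2) powr k \<le> ?f u \<or> (Y / 2) powr k \<le> ?f (u + h)"
        using k Y by (auto intro!: powr_mono2)
      then show ?thesis by (auto intro: add_increasing add_increasing2)
    qed simp
  qed
  also have "\<dots> = integral {p..q} ?f + integral {p + h..q + h} ?f"
    using pq by (subst integral_add) (auto intro!: int shift simp: shift)
  also have "\<dots> \<le> integral {p..p + h} ?f + integral {p + h..q + h} ?f"
    using pq k by (intro add_right_mono integral_Estar_powr_subset) auto
  also have "\<dots> = integral {p..q + h} ?f"
    using pq h by (intro Henstock_Kurzweil_Integration.integral_combine int) auto
  finally show ?thesis .
qed

lemma divisor_count_ge_1: "n > 0 \<Longrightarrow> divisor_count n \<ge> 1"
proof -
  assume n: "n > 0"
  then have "card {1 :: nat} \<le> card {d. d dvd n}" by (intro card_mono finite_divisors_nat) auto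
  then show ?thesis by (simp add: divisor_count_def)
qed

lemma divisor_sum_floor: "divisor_sum x = (\<Sum>n\<in>{1..nat \<lfloor>x\<rfloor>}. real (divisor_count n))"
proof -
  have "{n. 1 \<le> n \<and> real n \<le> x} = {1..nat \<lfloor>x\<rfloor>}"
    by (auto simp: le_nat_iff le_floor_iff) linarith+
  then show ?thesis by (simp add: divisor_sum_def)
qed

text \<open>
  As \<open>u\<close> passes to \<open>u + \<pi>/2\<close>, the argument \<open>2u/\<pi>\<close> of the last divisor sum crosses the odd number
  \<open>2m + 1\<close>, while those of the other two, being a half and a quarter of it, cross no integer.
\<close>

lemma divisor_step_at_odd_jump:
  assumes u: "pi * real m \<le> u" "u < pi * real m + pi / 2"
  shows "divisor_step (u + pi / 2) \<le> divisor_step u - pi"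
proof -
  define y where "y = 2 * u / pi - 2 * real m"
  have y: "0 \<le> y" "y < 1" using u pi_gt_zero by (auto simp: y_def field_simps)
  have u_eq: "u / (2 * pi) = (2 * real m + y) / 4" "u / pi = (2 * real m + y) / 2"
     "2 * u / pi = 2 * real m + y" by (auto simp: y_def)
  have v_eq: "(u + pi / 2) / (2 * pi) = (2 * real m + 1 + y) / 4" "(u + pi / 2) / pi = (2 * real m + 1 + y) / 2"
     "2 * (u + pi / 2) / pi = 2 * real m + 1 + y" by (auto simp: y_def field_simps)
  define r where "r = m mod 2"
  have r: "r \<le> 1" "real m = 2 * real (m div 2) + real r"
    unfolding r_def by (simp, metis mult_div_mod_eq of_nat_add of_nat_mult of_nat_numeral)
  have "\<lfloor>(2 * real m + y) / 4\<rfloor> = int (m div 2)"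
    using y r by (intro floor_unique) (simp_all add: field_simps)
  moreover have "\<lfloor>(2 * real m + 1 + y) / 4\<rfloor> = int (m div 2)"
    using y r by (intro floor_unique) (simp_all add: field_simps)
  moreover have "\<lfloor>(2 * real m + y) / 2\<rfloor> = int m"
    using y by (intro floor_unique) (simp_all add: field_simps)
  moreover have "\<lfloor>(2 * real m + 1 + y) / 2\<rfloor> = int m"
    using y by (intro floor_unique) (simp_all add: field_simps)
  moreover have "\<lfloor>2 * real m + y\<rfloor> = int (2 * m)"
    using y by (intro floor_unique) auto
  moreover have "\<lfloor>2 * real m + 1 + y\<rfloor> = int (Suc (2 * m))"
    using y by (intro floor_unique) auto
  ultimately have fl: "nat \<lfloor>(2 * real m + y) / 4\<rfloor> = nat \<lfloor>(2 * real m + 1 + y) / 4\<rfloor>"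
    "nat \<lfloor>(2 * real m + y) / 2\<rfloor> = nat \<lfloor>(2 * real m + 1 + y) / 2\<rfloor>"
    "nat \<lfloor>2 * real m + y\<rfloor> = 2 * m" "nat \<lfloor>2 * real m + 1 + y\<rfloor> = Suc (2 * m)"
    by (simp_all only: nat_int)
  have "divisor_step (u + pi / 2) = divisor_step u - pi * real (divisor_count (Suc (2 * m)))"
    unfolding divisor_step_def u_eq v_eq divisor_sum_floor fl by (simp add: field_simps)
  also have "\<dots> \<le> divisor_step u - pi * 1"
    using divisor_count_ge_1[of "Suc (2 * m)"] by (intro diff_left_mono mult_left_mono) auto
  finally show ?thesis by simp
qed

lemma integral_Estar_powr_ge_period:
  assumes "k \<ge> 0"
  shows "integral {pi * real m..pi * real (Suc m)} (\<lambda>t. \<bar>Estar t\<bar> powr k) \<ge> 1"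
proof -
  have "(pi * real m + pi / 2 - pi * real m) * (pi / 2) powr k
     \<le> integral {pi * real m..pi * real m + pi / 2 + pi / 2} (\<lambda>t. \<bar>Estar t\<bar> powr k)"
  proof (rule integral_Estar_powr_ge)
    fix u assume u: "pi * real m \<le> u" "u < pi * real m + pi / 2"
    then have "u \<ge> 0" using mult_nonneg_nonneg[of pi "real m"] by linarith
    then show "Estar (u + pi / 2) - Estar u \<ge> pi"
      using divisor_step_at_odd_jump[OF u] mean_sq_mono[of u "u + pi / 2"]
      by (simp add: Estar_eq)
  qed (use assms in auto)
  moreover have "pi / 2 \<ge> 1" using pi_gt3 by simp
  moreover from this have "(pi / 2) powr k \<ge> 1" using assms by (intro ge_one_powr_ge_zero)
  ultimately show ?thesis
    using mult_mono[of 1 "pi / 2" 1 "(pi / 2) powr k"] by (simp add: algebra_simps)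
qed

text \<open>
  On each period of length \<open>\<pi>\<close> the jump at the odd integer forces a moment of size at least 1.
\<close>

lemma integral_Estar_powr_ge_linear:
  assumes "k \<ge> 0" "T \<ge> 0"
  shows "integral {0..T} (\<lambda>t. \<bar>Estar t\<bar> powr k) \<ge> T / pi - 1"
proof -
  let ?F = "\<lambda>b. integral {0..b} (\<lambda>t. \<bar>Estar t\<bar> powr k)"
  have "?F (pi * real m) \<ge> real m" for m
  proof (induction m)
    case (Suc m)
    have "?F (pi * real (Suc m)) = ?F (pi * real m) +
        integral {pi * real m..pi * real (Suc m)} (\<lambda>t. \<bar>Estar t\<bar> powr k)"
      using assms by (intro Henstock_Kurzweil_Integration.integral_combine[symmetric] Estar_powr_integrable) auto
    then show ?case using Suc integral_Estar_powr_ge_period[OF assms(1), of m] by simp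
  qed simp
  from this[of "nat \<lfloor>T / pi\<rfloor>"] have "?F (pi * real (nat \<lfloor>T / pi\<rfloor>)) \<ge> T / pi - 1" by linarith
  also have "?F (pi * real (nat \<lfloor>T / pi\<rfloor>)) \<le> ?F T"
  proof -
    have "real (nat \<lfloor>T / pi\<rfloor>) \<le> T / pi" using assms by simp
    then have "pi * real (nat \<lfloor>T / pi\<rfloor>) \<le> T" by (simp add: field_simps)
    then show ?thesis using assms by (intro integral_Estar_powr_subset) auto
  qed
  finally show ?thesis .
qed

section \<open>Growth of zeta in the right half plane\<close>

lemma norm_powr_diff_le:
  fixes b z :: complex and N :: real
  assumes N: "N > 0" and b: "Re b \<le> 1" and z: "z \<in> closed_segment (of_real N) (of_real (N + 1))"
  shows "norm (z powr b - of_real N powr b) \<le> norm b * N powr (Re b - 1)"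
proof -
  let ?S = "closed_segment (complex_of_real N) (of_real (N + 1))"
  have S_eq: "?S = of_real ` {N..N + 1}"
    by (simp only: closed_segment_of_real closed_segment_eq_real_ivl) simp
  have S: "w \<in> \<real> \<and> Re w \<ge> N" if "w \<in> ?S" for w
    using that unfolding S_eq by auto
  have dist: "norm (w - of_real N) \<le> 1" if "w \<in> ?S" for w
    using that unfolding S_eq by (auto simp flip: of_real_diff)
  have "norm (z powr b - of_real N powr b) \<le> (norm b * N powr (Re b - 1)) * norm (z - of_real N)"
  proof (rule field_differentiable_bound[where S = ?S and f' = "\<lambda>w. b * w powr (b - 1)"])
    fix w assume w: "w \<in> ?S"
    have "w \<notin> \<real>\<^sub>\<le>\<^sub>0" using S[OF w] N by (auto simp: complex_nonpos_Reals_iff)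
    then show "((\<lambda>w. w powr b) has_field_derivative b * w powr (b - 1)) (at w within ?S)"
      by (intro has_field_derivative_powr DERIV_subset[OF _ subset_UNIV])
    have "norm (w powr (b - 1)) = Re w powr (Re b - 1)"
      using S[OF w] N by (subst norm_powr_real_powr) auto
    also have "\<dots> \<le> N powr (Re b - 1)"
      using S[OF w] N b by (intro powr_mono2') auto
    finally show "norm (b * w powr (b - 1)) \<le> norm b * N powr (Re b - 1)"
      by (simp add: norm_mult mult_left_mono)
  qed (use z in auto)
  also have "\<dots> \<le> (norm b * N powr (Re b - 1)) * 1"
    using dist[OF z] by (intro mult_left_mono) auto
  finally show ?thesis by simp
qed

text \<open>
  The remainder is \<open>f(N + 1) - f(N) - f'(N)\<close> for \<open>f(x) = x powr (1 - s)\<close> and \<open>N = n + 1\<close>. The mean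
  value inequality for \<open>f\<close> gives the case \<open>\<theta> = 0\<close>, applied to \<open>f'\<close> it gives \<open>\<theta> = 1\<close>, and the rest is
  interpolation.
\<close>

lemma norm_zeta_rem_1_le:
  assumes s: "Re s > 0" and \<theta>: "0 \<le> \<theta>" "\<theta> \<le> 1"
  shows "norm (zeta_rem 1 n s) \<le> 2 * norm (s - 1) * norm s powr \<theta> * real (Suc n) powr (- Re s - \<theta>)"
proof -
  define N where "N = real (Suc n)"
  define a where "a = 1 - s"
  let ?S = "closed_segment (complex_of_real N) (of_real (N + 1))"
  have N: "N > 0" by (simp add: N_def)
  have a: "norm a = norm (s - 1)" "norm (a - 1) = norm s" "Re a - 1 = - Re s" "Re (a - 1) = - Re s"
    by (simp_all add: a_def norm_minus_commute)
  have s0: "norm s > 0" using s by auto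
  have rem: "zeta_rem 1 n s = of_real (N + 1) powr a - of_real N powr a - a * of_real N powr (a - 1)"
    by (simp add: zeta_rem_def N_def a_def add_ac)
  have nN: "norm (of_real N powr b :: complex) = N powr Re b" for b
    using N by (subst norm_powr_real_powr) auto
  have end_S: "of_real (N + 1) \<in> ?S" by simp
  have first: "norm (zeta_rem 1 n s) \<le> 2 * (norm a * N powr (- Re s))"
  proof -
    have "norm (zeta_rem 1 n s) \<le> norm (of_real (N + 1) powr a - of_real N powr a)
        + norm (a * of_real N powr (a - 1))"
      unfolding rem by (rule norm_triangle_ineq4)
    also have "norm (of_real (N + 1) powr a - of_real N powr a) \<le> norm a * N powr (Re a - 1)"
      by (rule norm_powr_diff_le[OF N _ end_S]) (use s in \<open>simp add: a_def\<close>)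
    finally show ?thesis by (simp add: norm_mult nN a)
  qed
  have second: "norm (zeta_rem 1 n s) \<le> norm a * norm s * N powr (- Re s - 1)"
  proof -
    have "norm ((of_real (N + 1) powr a - a * of_real N powr (a - 1) * of_real (N + 1))
        - (of_real N powr a - a * of_real N powr (a - 1) * of_real N))
        \<le> (norm a * (norm s * N powr (- Re s - 1))) * norm (of_real (N + 1) - of_real N :: complex)"
    proof (rule field_differentiable_bound[where S = ?S and f' = "\<lambda>w. a * w powr (a - 1) - a * of_real N powr (a - 1)"])
      fix w assume w: "w \<in> ?S"
      have "?S = of_real ` {N..N + 1}"
        by (simp only: closed_segment_of_real closed_segment_eq_real_ivl) simp
      with w N have "w \<notin> \<real>\<^sub>\<le>\<^sub>0" by (auto simp: complex_nonpos_Reals_iff)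
      then show "((\<lambda>w. w powr a - a * of_real N powr (a - 1) * w) has_field_derivative
           a * w powr (a - 1) - a * of_real N powr (a - 1)) (at w within ?S)"
        by (auto intro!: derivative_eq_intros DERIV_subset[OF has_field_derivative_powr])
      have "norm (w powr (a - 1) - of_real N powr (a - 1)) \<le> norm (a - 1) * N powr (Re (a - 1) - 1)"
        by (rule norm_powr_diff_le[OF N _ w]) (use s in \<open>simp add: a_def\<close>)
      then have "norm (w powr (a - 1) - of_real N powr (a - 1)) \<le> norm s * N powr (- Re s - 1)"
        by (simp only: a)
      then show "norm (a * w powr (a - 1) - a * of_real N powr (a - 1)) \<le> norm a * (norm s * N powr (- Re s - 1))"
        by (simp add: norm_mult mult_left_mono flip: right_diff_distrib)
    qed auto
    then show ?thesis unfolding rem by (simp add: algebra_simps)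
  qed
  have "norm (zeta_rem 1 n s) \<le> 2 * norm a * N powr (- Re s) * (norm s / N) powr \<theta>"
  proof (cases "norm s / N \<ge> 1")
    case True
    then have "1 \<le> (norm s / N) powr \<theta>" using \<theta> by (intro ge_one_powr_ge_zero)
    then have "2 * norm a * N powr (- Re s) * 1 \<le> 2 * norm a * N powr (- Re s) * (norm s / N) powr \<theta>"
      by (intro mult_left_mono) auto
    with first show ?thesis by simp
  next
    case False
    have "norm s / N = (norm s / N) powr 1" using s0 N by simp
    also have "\<dots> \<le> (norm s / N) powr \<theta>" using False s0 N \<theta> by (intro powr_mono') auto
    finally have "norm a * N powr (- Re s) * (norm s / N) \<le> norm a * N powr (- Re s) * (norm s / N) powr \<theta>"
      by (intro mult_left_mono) auto
    moreover have "norm a * norm s * N powr (- Re s - 1) = norm a * N powr (- Re s) * (norm s / N)"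
      using N by (simp add: powr_diff)
    moreover have "norm a * N powr (- Re s) * (norm s / N) powr \<theta> \<ge> 0" by simp
    ultimately show ?thesis using second by linarith
  qed
  also have "\<dots> = 2 * norm (s - 1) * norm s powr \<theta> * N powr (- Re s - \<theta>)"
    using N s0 by (simp add: powr_divide powr_diff a)
  finally show ?thesis by (simp add: N_def)
qed

lemma zeta_eq_zeta_series:
  assumes "Re s > 1"
  shows "zeta s = zeta_series s"
  using is_zeta_zeta zeta_series_sums[OF assms] assms unfolding is_zeta_def by (metis sums_unique2)

text \<open>
  For \<open>Re s > 1\<close> this is the first instance of the recurrence for the Dirichlet series; the right
  hand side is holomorphic for \<open>Re s > 0\<close>.
\<close>

lemma zeta_times_eq_suminf_zeta_rem:
  assumes "Re s > 0" "s \<noteq> 1"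
  shows "(s - 1) * zeta s = 1 + (\<Sum>n. zeta_rem 1 n s)"
proof -
  let ?S = "{s. Re s > 0} - {1}"
  show ?thesis
  proof (rule analytic_continuation_open[where f = "\<lambda>s. (s - 1) * zeta s"
        and g = "\<lambda>s. 1 + (\<Sum>n. zeta_rem 1 n s)" and s = "{s. Re s > 1}" and s' = ?S])
    show "{s. Re s > 1} \<noteq> {}" by (auto intro!: exI[of _ 2])
    show "open ?S" by (intro open_Diff open_halfspace_Re_gt) auto
    show "connected ?S"
      by (intro connected_open_delete convex_connected convex_halfspace_Re_gt open_halfspace_Re_gt) auto
    show "(\<lambda>s. (s - 1) * zeta s) holomorphic_on ?S"
      by (intro holomorphic_intros holomorphic_on_subset[OF zeta_holomorphic]) auto
    show "(\<lambda>s. 1 + (\<Sum>n. zeta_rem 1 n s)) holomorphic_on ?S"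
      by (intro holomorphic_intros holomorphic_on_subset[OF zeta_rem_suminf_holomorphic[of 1]]) auto
    show "(z - 1) * zeta z = 1 + (\<Sum>n. zeta_rem 1 n z)" if "z \<in> {s. Re s > 1}" for z
      using that zeta_series_recurrence[of z 1] by (simp add: zeta_eq_zeta_series)
  qed (use assms in \<open>auto simp: open_halfspace_Re_gt\<close>)
qed

text \<open>
  Here \<open>\<theta>\<close> is at our disposal: \<open>\<theta> = 0\<close> bounds zeta for \<open>Re s \<ge> 1 + \<delta>\<close>, \<open>\<theta> = 1\<close> gives linear growth
  up to the line \<open>Re s = \<delta>\<close>, and \<open>\<theta> = 1/2 + \<delta>\<close> gives \<open>|\<zeta>(1/2 + it)|^2 \<le> C' t^(1 + 2 \<delta>)\<close>.
\<close>

lemma norm_zeta_le: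
  assumes "\<delta> > 0"
  obtains C where "C \<ge> 1"
    "\<And>s \<theta>. \<bar>Im s\<bar> \<ge> 1 \<Longrightarrow> 0 \<le> \<theta> \<Longrightarrow> \<theta> \<le> 1 \<Longrightarrow> Re s \<ge> 1 + \<delta> - \<theta> \<Longrightarrow> norm (zeta s) \<le> C * norm s powr \<theta>"
proof -
  have summ: "summable (\<lambda>n. real (Suc n) powr (- 1 - \<delta>))"
  proof -
    have "summable (\<lambda>n. real n powr (- 1 - \<delta>))"
      using assms by (subst summable_real_powr_iff) simp
    then show ?thesis by (subst summable_Suc_iff)
  qed
  define C where "C = 1 + 2 * (\<Sum>n. real (Suc n) powr (- 1 - \<delta>))"
  show ?thesis
  proof (rule that[of C])
    show "C \<ge> 1" unfolding C_def using suminf_nonneg[OF summ] by simp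
    fix s \<theta> assume s: "\<bar>Im s\<bar> \<ge> 1" and \<theta>: "0 \<le> \<theta>" "\<theta> \<le> 1" and Re: "Re s \<ge> 1 + \<delta> - \<theta>"
    have Re0: "Re s > 0" using Re \<theta> assms by linarith
    have s1: "norm s \<ge> 1" "norm (s - 1) \<ge> 1"
      using abs_Im_le_cmod[of s] abs_Im_le_cmod[of "s - 1"] s by auto
    have "norm (\<Sum>n. zeta_rem 1 n s) \<le> (\<Sum>n. 2 * norm (s - 1) * norm s powr \<theta> * real (Suc n) powr (- 1 - \<delta>))"
    proof (rule norm_suminf_le)
      fix n
      have "norm (zeta_rem 1 n s) \<le> 2 * norm (s - 1) * norm s powr \<theta> * real (Suc n) powr (- Re s - \<theta>)"
        by (rule norm_zeta_rem_1_le[OF Re0 \<theta>])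
      also have "\<dots> \<le> 2 * norm (s - 1) * norm s powr \<theta> * real (Suc n) powr (- 1 - \<delta>)"
        using Re by (intro mult_left_mono powr_mono) auto
      finally show "norm (zeta_rem 1 n s) \<le> 2 * norm (s - 1) * norm s powr \<theta> * real (Suc n) powr (- 1 - \<delta>)" .
    qed (intro summable_mult summ)
    also have "\<dots> = (C - 1) * norm (s - 1) * norm s powr \<theta>"
      using suminf_mult[OF summ, of "2 * norm (s - 1) * norm s powr \<theta>"] by (simp add: C_def mult_ac)
    finally have rem: "norm (\<Sum>n. zeta_rem 1 n s) \<le> (C - 1) * norm (s - 1) * norm s powr \<theta>" .
    have "norm (s - 1) * norm (zeta s) = norm (1 + (\<Sum>n. zeta_rem 1 n s))"
      using zeta_times_eq_suminf_zeta_rem[OF Re0] s1(2) norm_mult[of "s - 1" "zeta s"] by fastforce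
    also have "\<dots> \<le> 1 + norm (\<Sum>n. zeta_rem 1 n s)"
      using norm_triangle_ineq[of 1 "\<Sum>n. zeta_rem 1 n s"] by simp
    also have "\<dots> \<le> norm (s - 1) * norm s powr \<theta> + (C - 1) * norm (s - 1) * norm s powr \<theta>"
    proof (rule add_mono[OF _ rem])
      have "1 \<le> norm s powr \<theta>" using s1 \<theta> by (intro ge_one_powr_ge_zero)
      then show "1 \<le> norm (s - 1) * norm s powr \<theta>" using s1 mult_mono[of 1 "norm (s - 1)" 1 "norm s powr \<theta>"] by simp
    qed
    also have "\<dots> = norm (s - 1) * (C * norm s powr \<theta>)" by (simp add: algebra_simps)
    finally show "norm (zeta s) \<le> C * norm s powr \<theta>"
      using s1(2) by (subst (asm) mult_le_cancel_left_pos) auto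
  qed
qed

section \<open>Holomorphic functions on a rectangle\<close>

lemma norm_le_of_rectangle_boundary:
  fixes F :: "complex \<Rightarrow> complex"
  assumes hol: "F holomorphic_on cbox a b" and z: "z \<in> cbox a b"
    and bd: "\<And>w. w \<in> cbox a b \<Longrightarrow> Re w = Re a \<or> Re w = Re b \<or> Im w = Im a \<or> Im w = Im b \<Longrightarrow> norm (F w) \<le> B"
  shows "norm (F z) \<le> B"
proof -
  have fr: "w \<in> cbox a b \<and> (Re w = Re a \<or> Re w = Re b \<or> Im w = Im a \<or> Im w = Im b)"
    if "w \<in> frontier (cbox a b)" for w
  proof -
    have "w \<in> cbox a b" "w \<notin> box a b"
      using that by (auto simp: frontier_def interior_cbox)
    then show ?thesis by (auto simp: in_cbox_complex_iff in_box_complex_iff)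
  qed
  show ?thesis
  proof (rule maximum_modulus_frontier[of F "cbox a b"])
    show "F holomorphic_on interior (cbox a b)"
      by (rule holomorphic_on_subset[OF hol interior_subset])
    show "continuous_on (closure (cbox a b)) F"
      using holomorphic_on_imp_continuous_on[OF hol] by (simp add: closure_closed)
    show "norm (F w) \<le> B" if "w \<in> frontier (cbox a b)" for w
      using fr[OF that] bd by blast
  qed (use z in \<open>auto intro: bounded_cbox\<close>)
qed

text \<open>
  Cauchy's formula on the boundary, with a sup bound on three edges and an \<open>L\<^sup>1\<close> bound on the left
  edge. A pointwise value is thereby controlled by a mean over a vertical line, as long as the
  point stays at distance \<open>\<rho>\<close> from that line.
\<close>

lemma norm_le_left_edge_integral:
  fixes F :: "complex \<Rightarrow> complex"
  assumes hol: "F holomorphic_on cbox a b" and z: "z \<in> box a b"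
    and \<rho>: "\<rho> > 0" "\<And>w. w \<in> path_image (rectpath a b) \<Longrightarrow> norm (w - z) \<ge> \<rho>"
    and B: "B \<ge> 0" "\<And>w. w \<in> cbox a b \<Longrightarrow> Im w = Im a \<or> Im w = Im b \<Longrightarrow> norm (F w) \<le> B"
    and R: "R \<ge> 0" "\<And>w. w \<in> cbox a b \<Longrightarrow> Re w = Re b \<Longrightarrow> norm (F w) \<le> R"
    and left: "\<And>t. t \<in> {Im a..Im b} \<Longrightarrow> norm (F (Complex (Re a) t)) \<le> g t"
      "g integrable_on {Im a..Im b}"
  shows "\<rho> * norm (F z) \<le> integral {Im a..Im b} g + 2 * (Re b - Re a) * B + (Im b - Im a) * R"
proof -
  have less: "Re a < Re b" "Im a < Im b" using z by (auto simp: in_box_complex_iff)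
  define a2 a4 where "a2 = Complex (Re b) (Im a)" and "a4 = Complex (Re a) (Im b)"
  let ?G = "\<lambda>w. F w / (w - z)"
  have rp: "rectpath a b = linepath a a2 +++ linepath a2 b +++ linepath b a4 +++ linepath a4 a"
    by (simp add: rectpath_def a2_def a4_def Let_def)
  have sub: "path_image (rectpath a b) \<subseteq> cbox a b"
    using less by (intro path_image_rectpath_subset_cbox) auto
  have zn: "z \<notin> path_image (rectpath a b)" using \<rho>(1) \<rho>(2)[of z] by auto
  have "(?G has_contour_integral (2 * pi * \<i> * winding_number (rectpath a b) z * F z)) (rectpath a b)"
    using sub zn z by (intro Cauchy_integral_formula_convex_simple[OF _ hol]) (auto simp: interior_cbox)
  then have ci: "(?G has_contour_integral (2 * pi * \<i> * F z)) (rectpath a b)"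
    using winding_number_rectpath[OF z] by simp
  have segs: "closed_segment a a2 \<union> closed_segment a2 b \<union> closed_segment b a4 \<union> closed_segment a4 a
      = path_image (rectpath a b)"
    unfolding rp by (simp add: path_image_join Un_assoc)
  from ci obtain i1 i2 i3 i4 where i:
    "(?G has_contour_integral i1) (linepath a a2)" "(?G has_contour_integral i2) (linepath a2 b)"
    "(?G has_contour_integral i3) (linepath b a4)" "(?G has_contour_integral i4) (linepath a4 a)"
    "2 * pi * \<i> * F z = i1 + i2 + i3 + i4"
  proof -
    have int: "?G contour_integrable_on rectpath a b" using ci by (auto simp: contour_integrable_on_def)
    then have "?G contour_integrable_on linepath a a2" "?G contour_integrable_on linepath a2 b"
      "?G contour_integrable_on linepath b a4" "?G contour_integrable_on linepath a4 a"
      unfolding rp by (auto simp: contour_integrable_join valid_path_join)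
    then obtain i1 i2 i3 i4 where j: "(?G has_contour_integral i1) (linepath a a2)" "(?G has_contour_integral i2) (linepath a2 b)"
    "(?G has_contour_integral i3) (linepath b a4)" "(?G has_contour_integral i4) (linepath a4 a)"
      unfolding contour_integrable_on_def by blast
    have "(?G has_contour_integral (i1 + (i2 + (i3 + i4)))) (rectpath a b)"
      unfolding rp by (intro has_contour_integral_join j valid_path_join) auto
    then have "2 * pi * \<i> * F z = i1 + i2 + i3 + i4"
      using has_contour_integral_unique[OF ci] by (simp add: add.assoc)
    with j show ?thesis by (rule that)
  qed
  have edge: "norm (?G w) \<le> norm (F w) / \<rho>" if "w \<in> path_image (rectpath a b)" for w
    using \<rho>(1) \<rho>(2)[OF that] by (simp add: norm_divide frac_le)
  have edgeB: "norm (?G w) \<le> M / \<rho>" if "w \<in> path_image (rectpath a b)" "norm (F w) \<le> M" for w M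
    using edge[OF that(1)] divide_right_mono[OF that(2), of \<rho>] \<rho>(1) by linarith
  have im: "closed_segment a a2 \<subseteq> {w. Im w = Im a}" "closed_segment b a4 \<subseteq> {w. Im w = Im b}"
     "closed_segment a2 b \<subseteq> {w. Re w = Re b}"
    by (auto simp: a2_def a4_def closed_segment_same_Im closed_segment_same_Re)
  have b1: "norm i1 \<le> B / \<rho> * norm (a2 - a)"
    using im segs sub B \<rho>(1) by (intro has_contour_integral_bound_linepath[OF i(1)] edgeB B(2)) auto
  have b3: "norm i3 \<le> B / \<rho> * norm (a4 - b)"
    using im segs sub B \<rho>(1) by (intro has_contour_integral_bound_linepath[OF i(3)] edgeB B(2)) auto
  have b2: "norm i2 \<le> R / \<rho> * norm (b - a2)"
    using im segs sub R \<rho>(1) by (intro has_contour_integral_bound_linepath[OF i(2)] edgeB R(2)) auto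
  have nrm: "norm (a2 - a) = Re b - Re a" "norm (a4 - b) = Re b - Re a" "norm (b - a2) = Im b - Im a"
    using less by (auto simp: a2_def a4_def cmod_def)
  have b4: "norm i4 \<le> integral {Im a..Im b} g / \<rho>"
  proof -
    have "(?G has_contour_integral (- i4)) (linepath a a4)"
      using has_contour_integral_reversepath[OF _ i(4)] by simp
    then have hi: "((\<lambda>x. ?G (Complex (Re a) x)) has_integral (- \<i> * (- i4))) {Im a..Im b}"
      by (subst (asm) has_contour_integral_linepath_same_Re_iff[of _ "Re a" _ "Im a" "Im b"])
         (use less in \<open>auto simp: a4_def\<close>)
    have mem: "Complex (Re a) x \<in> path_image (rectpath a b)" if "x \<in> {Im a..Im b}" for x
      using that less by (subst path_image_rectpath) (auto simp: closed_segment_same_Re closed_segment_eq_real_ivl)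
    have "norm (integral {Im a..Im b} (\<lambda>x. ?G (Complex (Re a) x))) \<le> integral {Im a..Im b} (\<lambda>x. g x / \<rho>)"
      using hi left mem by (intro integral_norm_bound_integral edgeB integrable_on_divide) auto
    then show ?thesis using hi by (simp add: has_integral_iff norm_mult)
  qed
  have "2 * norm (F z) \<le> 2 * pi * norm (F z)"
    using pi_gt3 by (intro mult_right_mono) auto
  also have "\<dots> = norm (i1 + i2 + i3 + i4)"
    unfolding i(5)[symmetric] by (simp add: norm_mult)
  also have "\<dots> \<le> norm i1 + norm i2 + norm i3 + norm i4"
    by (intro order_trans[OF norm_triangle_ineq] add_right_mono) auto
  also have "\<dots> \<le> (integral {Im a..Im b} g + 2 * (Re b - Re a) * B + (Im b - Im a) * R) / \<rho>"
  proof -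
    have "(integral {Im a..Im b} g + 2 * (Re b - Re a) * B + (Im b - Im a) * R) / \<rho>
      = B / \<rho> * (Re b - Re a) + R / \<rho> * (Im b - Im a) + B / \<rho> * (Re b - Re a) + integral {Im a..Im b} g / \<rho>"
      using \<rho>(1) by (simp add: field_simps)
    then show ?thesis using b1 b2 b3 b4 unfolding nrm by linarith
  qed
  finally have "2 * norm (F z) \<le> (integral {Im a..Im b} g + 2 * (Re b - Re a) * B + (Im b - Im a) * R) / \<rho>" .
  moreover have "norm (F z) \<le> 2 * norm (F z)" by simp
  ultimately have "norm (F z) \<le> (integral {Im a..Im b} g + 2 * (Re b - Re a) * B + (Im b - Im a) * R) / \<rho>"
    by linarith
  then show ?thesis using \<rho>(1) by (simp add: field_simps)
qed

section \<open>Local means on the critical line\<close>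

lemma zeta_linear_bound:
  obtains C where "C \<ge> 1"
    "\<And>s. \<bar>Im s\<bar> \<ge> 1 \<Longrightarrow> Re s \<ge> 1 / 4 \<Longrightarrow> norm (zeta s) \<le> C * norm s"
    "\<And>s. \<bar>Im s\<bar> \<ge> 1 \<Longrightarrow> Re s \<ge> 5 / 4 \<Longrightarrow> norm (zeta s) \<le> C"
proof -
  obtain C where C: "C \<ge> 1" "\<And>s \<theta>. \<bar>Im s\<bar> \<ge> 1 \<Longrightarrow> 0 \<le> \<theta> \<Longrightarrow> \<theta> \<le> 1 \<Longrightarrow> Re s \<ge> 1 + 1 / 4 - \<theta> \<Longrightarrow>
      norm (zeta s) \<le> C * norm s powr \<theta>"
    using norm_zeta_le[of "1 / 4"] by auto
  show ?thesis
  proof (rule that[OF C(1)])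
    fix s :: complex assume s: "\<bar>Im s\<bar> \<ge> 1"
    then have "s \<noteq> 0" by auto
    then show "norm (zeta s) \<le> C * norm s" if "Re s \<ge> 1 / 4"
      using C(2)[of s 1] s that by simp
    show "norm (zeta s) \<le> C" if "Re s \<ge> 5 / 4"
      using C(2)[of s 0] s that \<open>s \<noteq> 0\<close> by simp
  qed
qed

lemma norm_zeta_sq_le_quadratic:
  assumes lin: "\<And>s. \<bar>Im s\<bar> \<ge> 1 \<Longrightarrow> Re s \<ge> 1 / 4 \<Longrightarrow> norm (zeta s) \<le> C * norm s"
    and "C \<ge> 0" "1 / 4 \<le> Re s" "Re s \<le> 2" "1 \<le> Im s" "Im s + 2 \<le> 2 * T"
  shows "(norm (zeta s))\<^sup>2 \<le> 4 * C\<^sup>2 * T\<^sup>2"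
proof -
  have "norm (zeta s) \<le> C * norm s" using assms by (intro lin) auto
  also have "\<dots> \<le> C * (2 * T)"
    using assms cmod_le[of s] by (intro mult_left_mono) auto
  finally have "(norm (zeta s))\<^sup>2 \<le> (C * (2 * T))\<^sup>2" by (intro power_mono) auto
  then show ?thesis by (simp add: power_mult_distrib)
qed

lemma exp_neg_ln_square_le:
  fixes T :: real
  assumes "T \<ge> 1" "ln T \<ge> 3"
  shows "T\<^sup>2 * exp (- (ln T)\<^sup>2) \<le> 1 / T"
proof -
  have "3 * ln T \<le> (ln T)\<^sup>2" using assms by (simp add: power2_eq_square mult_right_mono)
  then have "exp (- (ln T)\<^sup>2) \<le> exp (- (3 * ln T))" by simp
  also have "exp (- (3 * ln T)) = 1 / T ^ 3"
    using assms exp_of_nat_mult[of 3 "ln T"] by (simp add: exp_minus field_simps)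
  finally have "T\<^sup>2 * exp (- (ln T)\<^sup>2) \<le> T\<^sup>2 * (1 / T ^ 3)" by (intro mult_left_mono) auto
  also have "\<dots> = 1 / T" using assms by (simp add: power2_eq_square power3_eq_cube)
  finally show ?thesis .
qed

lemma zeta_holomorphic_cbox:
  assumes "Im a > 0"
  shows "zeta holomorphic_on cbox a b"
  by (rule holomorphic_on_subset[OF zeta_holomorphic]) (use assms in \<open>auto simp: in_cbox_complex_iff\<close>)

text \<open>
  Cauchy's formula for \<open>\<zeta>(s)^2 exp ((s - s1)^2)\<close> on a rectangle between the lines \<open>Re s = 1/2\<close> and
  \<open>Re s = 2\<close>. The Gaussian factor is \<open>exp (- (ln T)^2)\<close> on the horizontal edges, which beats every
  power of \<open>T\<close>.
\<close>

lemma norm_zeta_right_of_line_le: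
  assumes C: "C \<ge> 1" "\<And>s. \<bar>Im s\<bar> \<ge> 1 \<Longrightarrow> Re s \<ge> 1 / 4 \<Longrightarrow> norm (zeta s) \<le> C * norm s"
      "\<And>s. \<bar>Im s\<bar> \<ge> 1 \<Longrightarrow> Re s \<ge> 5 / 4 \<Longrightarrow> norm (zeta s) \<le> C"
    and \<rho>: "0 < \<rho>" "\<rho> \<le> 1 / 8"
    and T: "ln T \<ge> 3" "T \<ge> 1" "ln T + 1 \<le> u" "u + ln T + 2 \<le> 2 * T"
  shows "\<rho> * (norm (zeta (Complex (1 / 2 + \<rho>) u)))\<^sup>2 \<le>
    exp (9 / 4) * (integral {u - ln T..u + ln T} zeta_sq + 12 * C\<^sup>2 + 2 * C\<^sup>2 * ln T)"
proof -
  define H where "H = ln T"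
  define s1 where "s1 = Complex (1 / 2 + \<rho>) u"
  define F where "F s = (zeta s)\<^sup>2 * exp ((s - s1)\<^sup>2)" for s
  define a b where "a = Complex (1 / 2) (u - H)" and "b = Complex 2 (u + H)"
  note ab = a_def b_def s1_def
  have H: "H \<ge> 3" "H + 1 \<le> u" "u + H + 2 \<le> 2 * T" using T by (auto simp: H_def)
  have nF: "norm (F s) = (norm (zeta s))\<^sup>2 * exp ((Re s - (1 / 2 + \<rho>))\<^sup>2 - (Im s - u)\<^sup>2)" for s
    by (simp add: F_def norm_mult norm_power s1_def Re_power2)
  have re: "(Re s - (1 / 2 + \<rho>))\<^sup>2 \<le> 9 / 4" if "s \<in> cbox a b" for s
  proof -
    have "1 / 2 \<le> Re s" "Re s \<le> 2" using that by (auto simp: in_cbox_complex_iff ab)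
    then have "\<bar>Re s - (1 / 2 + \<rho>)\<bar> \<le> 3 / 2" using \<rho> by (intro abs_leI) linarith+
    then have "\<bar>Re s - (1 / 2 + \<rho>)\<bar>\<^sup>2 \<le> (3 / 2)\<^sup>2" by (intro power_mono) auto
    then show ?thesis by (simp add: power2_eq_square)
  qed
  have nF_le: "norm (F s) \<le> (norm (zeta s))\<^sup>2 * exp (9 / 4)" if "s \<in> cbox a b" for s
  proof -
    have "(Re s - (1 / 2 + \<rho>))\<^sup>2 - (Im s - u)\<^sup>2 \<le> 9 / 4"
      using re[OF that] zero_le_power2[of "Im s - u"] by linarith
    then show ?thesis unfolding nF by (intro mult_left_mono) auto
  qed
  have quad: "(norm (zeta s))\<^sup>2 \<le> 4 * C\<^sup>2 * T\<^sup>2" if "s \<in> cbox a b" for s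
    using that H C by (intro norm_zeta_sq_le_quadratic C(2)) (auto simp: in_cbox_complex_iff ab)
  have "\<rho> * norm (F s1) \<le> integral {Im a..Im b} (\<lambda>t. exp (9 / 4) * zeta_sq t)
      + 2 * (Re b - Re a) * (4 * C\<^sup>2 * exp (9 / 4)) + (Im b - Im a) * (C\<^sup>2 * exp (9 / 4))"
  proof (rule norm_le_left_edge_integral[where F = F and a = a and b = b and z = s1])
    show "F holomorphic_on cbox a b" unfolding F_def
      using H by (intro holomorphic_intros zeta_holomorphic_cbox) (auto simp: ab)
    show "s1 \<in> box a b" using \<rho> H by (auto simp: ab in_box_complex_iff)
    show "\<rho> > 0" by fact
    fix w assume "w \<in> path_image (rectpath a b)"
    then have "Re w = 1 / 2 \<or> Re w = 2 \<or> Im w = u - H \<or> Im w = u + H"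
      using H by (subst (asm) path_image_rectpath) (auto simp: ab closed_segment_same_Re closed_segment_same_Im)
    then have "\<bar>Re (w - s1)\<bar> \<ge> \<rho> \<or> \<bar>Im (w - s1)\<bar> \<ge> \<rho>" using \<rho> H by (auto simp: ab)
    then show "norm (w - s1) \<ge> \<rho>"
      using abs_Re_le_cmod[of "w - s1"] abs_Im_le_cmod[of "w - s1"] by linarith
  next
    fix w assume w: "w \<in> cbox a b" "Im w = Im a \<or> Im w = Im b"
    then have "(Im w - u)\<^sup>2 = H\<^sup>2" by (auto simp: ab)
    then have "norm (F w) = (norm (zeta w))\<^sup>2 * (exp ((Re w - (1 / 2 + \<rho>))\<^sup>2) * exp (- H\<^sup>2))"
      unfolding nF by (simp flip: exp_add)
    also have "\<dots> \<le> (4 * C\<^sup>2 * T\<^sup>2) * (exp (9 / 4) * exp (- H\<^sup>2))"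
      using quad[OF w(1)] re[OF w(1)] by (intro mult_mono) auto
    also have "\<dots> = 4 * C\<^sup>2 * exp (9 / 4) * (T\<^sup>2 * exp (- H\<^sup>2))" by simp
    also have "\<dots> \<le> 4 * C\<^sup>2 * exp (9 / 4) * 1"
    proof (rule mult_left_mono)
      have "1 / T \<le> 1" using T by simp
      with exp_neg_ln_square_le[OF T(2,1)] show "T\<^sup>2 * exp (- H\<^sup>2) \<le> 1" unfolding H_def by linarith
    qed simp
    finally show "norm (F w) \<le> 4 * C\<^sup>2 * exp (9 / 4)" by simp
  next
    fix w assume w: "w \<in> cbox a b" "Re w = Re b"
    have "norm (zeta w) \<le> C" using w H by (intro C(3)) (auto simp: in_cbox_complex_iff ab)
    then have "(norm (zeta w))\<^sup>2 \<le> C\<^sup>2" by (intro power_mono) auto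
    then have "(norm (zeta w))\<^sup>2 * exp (9 / 4) \<le> C\<^sup>2 * exp (9 / 4)" by (intro mult_right_mono) auto
    with nF_le[OF w(1)] show "norm (F w) \<le> C\<^sup>2 * exp (9 / 4)" by linarith
  next
    fix t assume t: "t \<in> {Im a..Im b}"
    then have "Complex (Re a) t \<in> cbox a b" by (auto simp: in_cbox_complex_iff ab)
    from nF_le[OF this] show "norm (F (Complex (Re a) t)) \<le> exp (9 / 4) * zeta_sq t"
      by (simp add: zeta_sq_def ab mult.commute)
  next
    show "(\<lambda>t. exp (9 / 4) * zeta_sq t) integrable_on {Im a..Im b}"
      by (intro integrable_on_mult_right zeta_sq_integrable)
  qed (use C in auto)
  also have "norm (F s1) = (norm (zeta s1))\<^sup>2" unfolding nF by (simp add: s1_def)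
  also have "integral {Im a..Im b} (\<lambda>t. exp (9 / 4) * zeta_sq t) = exp (9 / 4) * integral {u - H..u + H} zeta_sq"
    by (simp add: ab)
  also have "2 * (Re b - Re a) * (4 * C\<^sup>2 * exp (9 / 4)) = exp (9 / 4) * (12 * C\<^sup>2)"
    by (simp add: ab)
  also have "(Im b - Im a) * (C\<^sup>2 * exp (9 / 4)) = exp (9 / 4) * (2 * C\<^sup>2 * H)" by (simp add: ab)
  finally show ?thesis unfolding s1_def H_def by (simp add: algebra_simps)
qed

text \<open>
  A point on the critical line itself cannot be reached from the right alone; the trivial
  polynomial bound on \<open>Re s = 1/4\<close> has to supply the other side. The weight \<open>T^(8 (s - s0))\<close> reduces
  that edge to \<open>O(1)\<close> and enlarges the right edge only by \<open>T^(8 \<rho>)\<close>, which is a small power of \<open>T\<close> since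
  \<open>\<rho>\<close> may be small. This is a quantitative three lines argument.
\<close>

lemma zeta_sq_le_right_of_line:
  assumes C: "C \<ge> 1" "\<And>s. \<bar>Im s\<bar> \<ge> 1 \<Longrightarrow> Re s \<ge> 1 / 4 \<Longrightarrow> norm (zeta s) \<le> C * norm s"
    and \<rho>: "0 < \<rho>" "\<rho> \<le> 1 / 8"
    and T: "ln T \<ge> 3" "T \<ge> 1" "ln T + 1 \<le> t" "t + ln T + 2 \<le> 2 * T"
    and M: "\<And>u. \<bar>u - t\<bar> \<le> ln T \<Longrightarrow> (norm (zeta (Complex (1 / 2 + \<rho>) u)))\<^sup>2 \<le> M" "M \<ge> 4 * C\<^sup>2"
  shows "zeta_sq t \<le> exp 1 * M * T powr (8 * \<rho>)"
proof -
  define H where "H = ln T"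
  define s0 where "s0 = Complex (1 / 2) t"
  define F where "F s = (zeta s)\<^sup>2 * exp ((s - s0)\<^sup>2 + of_real (8 * H) * (s - s0))" for s
  define a b where "a = Complex (1 / 4) (t - H)" and "b = Complex (1 / 2 + \<rho>) (t + H)"
  note ab = a_def b_def s0_def
  have H: "H \<ge> 3" "H + 1 \<le> t" "t + H + 2 \<le> 2 * T" using T by (auto simp: H_def)
  have nF: "norm (F s) = (norm (zeta s))\<^sup>2 * (exp ((Re s - 1 / 2)\<^sup>2) * exp (- (Im s - t)\<^sup>2) * exp (8 * H * (Re s - 1 / 2)))" for s
    by (simp add: F_def norm_mult norm_power s0_def Re_power2 flip: exp_add)
  have re: "exp ((Re s - 1 / 2)\<^sup>2) \<le> exp 1" if "s \<in> cbox a b" for s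
  proof -
    have "\<bar>Re s - 1 / 2\<bar> \<le> 1" using that \<rho> by (auto simp: in_cbox_complex_iff ab)
    then have "\<bar>Re s - 1 / 2\<bar>\<^sup>2 \<le> 1\<^sup>2" by (intro power_mono) auto
    then show ?thesis by simp
  qed
  have quad: "(norm (zeta s))\<^sup>2 \<le> 4 * C\<^sup>2 * T\<^sup>2" if "s \<in> cbox a b" for s
    using that H C \<rho> by (intro norm_zeta_sq_le_quadratic C(2)) (auto simp: in_cbox_complex_iff ab)
  have expT: "exp (x * H) = T powr x" for x using T by (simp add: powr_def H_def)
  have T1: "T powr (8 * \<rho>) \<ge> 1" using T \<rho> by (intro ge_one_powr_ge_zero) auto
  have M0: "M \<ge> 0" using M(2) zero_le_power2[of C] by linarith
  have const: "4 * C\<^sup>2 * exp 1 \<le> exp 1 * M * T powr (8 * \<rho>)"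
    using mult_mono[OF M(2) T1] M0 by (simp add: mult_ac mult_left_mono)
  have "norm (F s0) \<le> exp 1 * M * T powr (8 * \<rho>)"
  proof (rule norm_le_of_rectangle_boundary[where F = F and a = a and b = b and z = s0])
    show "F holomorphic_on cbox a b" unfolding F_def
      using H by (intro holomorphic_intros zeta_holomorphic_cbox) (auto simp: ab)
    show "s0 \<in> cbox a b" using \<rho> H by (auto simp: ab in_cbox_complex_iff)
    fix w assume w: "w \<in> cbox a b" and edge: "Re w = Re a \<or> Re w = Re b \<or> Im w = Im a \<or> Im w = Im b"
    have e0: "exp (- (Im w - t)\<^sup>2) \<le> 1" by simp
    have shift: "exp (8 * H * (Re w - 1 / 2)) = T powr (8 * (Re w - 1 / 2))"
      using expT[of "8 * (Re w - 1 / 2)"] by (simp add: mult_ac)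
    from edge consider "Re w = Re b" | "Re w = Re a" | "Im w = Im a \<or> Im w = Im b" by blast
    then show "norm (F w) \<le> exp 1 * M * T powr (8 * \<rho>)"
    proof cases
      case 1
      have "w = Complex (1 / 2 + \<rho>) (Im w)" using 1 by (simp add: ab complex_eq_iff)
      moreover have "\<bar>Im w - t\<bar> \<le> ln T" using w by (auto simp: in_cbox_complex_iff ab H_def)
      ultimately have "(norm (zeta w))\<^sup>2 \<le> M" using M(1) by metis
      then have "norm (F w) \<le> M * (exp 1 * 1 * T powr (8 * \<rho>))"
        unfolding nF shift using re[OF w] e0 1 M0 by (intro mult_mono) (auto simp: ab)
      then show ?thesis by (simp add: mult_ac)
    next
      case 2
      have Re_w: "Re w = 1 / 4" using 2 by (simp add: ab)
      have "8 * (Re w - 1 / 2) = - 2" by (simp add: Re_w)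
      with shift have "exp (8 * H * (Re w - 1 / 2)) = T powr (- 2)" by (simp only:)
      then have "norm (F w) \<le> (4 * C\<^sup>2 * T\<^sup>2) * (exp 1 * 1 * T powr (- 2))"
        unfolding nF using re[OF w] e0 quad[OF w] by (intro mult_mono) auto
      also have "\<dots> = 4 * C\<^sup>2 * exp 1" using T by (simp add: powr_minus powr_numeral field_simps)
      finally show ?thesis using const by linarith
    next
      case 3
      then have "(Im w - t)\<^sup>2 = H\<^sup>2" by (auto simp: ab)
      then have "norm (F w) \<le> (4 * C\<^sup>2 * T\<^sup>2) * (exp 1 * exp (- H\<^sup>2) * T powr 1)"
        unfolding nF shift using re[OF w] quad[OF w] \<rho> w T
        by (intro mult_mono powr_mono) (auto simp: ab in_cbox_complex_iff)
      also have "\<dots> = 4 * C\<^sup>2 * exp 1 * T * (T\<^sup>2 * exp (- H\<^sup>2))" using T by simp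
      also have "\<dots> \<le> 4 * C\<^sup>2 * exp 1 * T * (1 / T)"
        unfolding H_def using T by (intro mult_left_mono exp_neg_ln_square_le) auto
      also have "\<dots> = 4 * C\<^sup>2 * exp 1" using T by simp
      finally show ?thesis using const by linarith
    qed
  qed
  also have "norm (F s0) = zeta_sq t" unfolding nF by (simp add: s0_def zeta_sq_def)
  finally show ?thesis .
qed

text \<open>
  The two preceding bounds, with \<open>8 \<rho> \<le> \<eta>/2\<close>; constants and logarithms are absorbed into powers of
  \<open>T powr (\<eta> / 4)\<close>. The window \<open>T powr \<eta>\<close> contains the windows of half-length \<open>ln T\<close> used there.
\<close>

lemma zeta_sq_le_local_mean:
  assumes "\<eta> > 0"
  shows "\<forall>\<^sub>F T in at_top. \<forall>t. 2 * T powr \<eta> \<le> t \<and> t \<le> T \<longrightarrow>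
    zeta_sq t \<le> T powr \<eta> * (1 + (mean_sq (t + T powr \<eta>) - mean_sq (t - T powr \<eta>)))"
proof -
  obtain C where C: "C \<ge> 1"
    "\<And>s. \<bar>Im s\<bar> \<ge> 1 \<Longrightarrow> Re s \<ge> 1 / 4 \<Longrightarrow> norm (zeta s) \<le> C * norm s"
    "\<And>s. \<bar>Im s\<bar> \<ge> 1 \<Longrightarrow> Re s \<ge> 5 / 4 \<Longrightarrow> norm (zeta s) \<le> C"
    using zeta_linear_bound by blast
  define \<rho> where "\<rho> = min (1 / 8) (\<eta> / 16)"
  have \<rho>: "0 < \<rho>" "\<rho> \<le> 1 / 8" "8 * \<rho> \<le> \<eta> / 2" using assms by (auto simp: \<rho>_def)
  define K where "K = exp (9 / 4) / \<rho> * (14 * C\<^sup>2)"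
  have "\<forall>\<^sub>F T in at_top. ln T \<ge> (3 :: real)" by real_asymp
  moreover have "\<forall>\<^sub>F T in at_top. T \<ge> (1 :: real)" by real_asymp
  moreover have "\<forall>\<^sub>F T in at_top. 2 * ln T + 2 \<le> (T :: real)" by real_asymp
  moreover have "\<forall>\<^sub>F T in at_top. 2 * ln T \<le> T powr (\<eta> / 4)" using assms by real_asymp
  moreover have "\<forall>\<^sub>F T in at_top. exp 1 * K \<le> T powr (\<eta> / 4)" using assms by real_asymp
  ultimately show ?thesis
  proof eventually_elim
    case (elim T)
    note T = elim
    define G where "G = T powr \<eta>"
    have G4: "T powr (\<eta> / 4) \<le> G" unfolding G_def using T assms by (intro powr_mono) auto
    have HG: "2 * ln T \<le> G" "G \<ge> 0" using T(4) G4 by (linarith, simp add: G_def)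
    show ?case
    proof (intro allI impI)
      fix t assume "2 * T powr \<eta> \<le> t \<and> t \<le> T"
      then have t: "2 * G \<le> t" "t \<le> T" by (auto simp: G_def)
      define J where "J = mean_sq (t + G) - mean_sq (t - G)"
      have J: "J \<ge> 0" unfolding J_def using mean_sq_mono[of "t - G" "t + G"] t HG by simp
      have "zeta_sq t \<le> exp 1 * (K * T powr (\<eta> / 4) * (1 + J)) * T powr (8 * \<rho>)"
      proof (rule zeta_sq_le_right_of_line[OF C(1,2) \<rho>(1,2)])
        show "4 * C\<^sup>2 \<le> K * T powr (\<eta> / 4) * (1 + J)"
        proof -
          have "1 \<le> exp (9 / 4 :: real)" by (subst one_le_exp_iff) simp
          with \<rho> have "\<rho> \<le> exp (9 / 4)" by linarith
          with \<rho> have "1 \<le> exp (9 / 4) / \<rho>" by simp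
          then have "1 * (4 * C\<^sup>2) \<le> K" unfolding K_def by (intro mult_mono) auto
          moreover from this have "0 \<le> K" using zero_le_power2[of C] by linarith
          moreover have "1 \<le> T powr (\<eta> / 4)" using T assms by (intro ge_one_powr_ge_zero) auto
          moreover have "1 \<le> 1 + J" using J by simp
          ultimately have "4 * C\<^sup>2 * 1 * 1 \<le> K * T powr (\<eta> / 4) * (1 + J)"
            by (intro mult_mono) auto
          then show ?thesis by simp
        qed
        fix u assume u: "\<bar>u - t\<bar> \<le> ln T"
        define I where "I = integral {u - ln T..u + ln T} zeta_sq"
        have "\<rho> * (norm (zeta (Complex (1 / 2 + \<rho>) u)))\<^sup>2 \<le> exp (9 / 4) * (I + 12 * C\<^sup>2 + 2 * C\<^sup>2 * ln T)"
          unfolding I_def by (rule norm_zeta_right_of_line_le[OF C \<rho>(1,2)]) (use T t HG u in auto)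
        also have "I + 12 * C\<^sup>2 + 2 * C\<^sup>2 * ln T \<le> 14 * C\<^sup>2 * (T powr (\<eta> / 4) * (1 + J))"
        proof -
          have "I \<le> J"
          proof -
            have "J = integral {t - G..t + G} zeta_sq" unfolding J_def using t HG by (intro mean_sq_diff) auto
            moreover have "I \<le> integral {t - G..t + G} zeta_sq" unfolding I_def
              using u HG zeta_sq_nonneg by (intro integral_subset_le zeta_sq_integrable) auto
            ultimately show ?thesis by simp
          qed
          define P where "P = T powr (\<eta> / 4)"
          have P: "1 \<le> P" "2 * ln T \<le> P" unfolding P_def using T assms by (auto intro: ge_one_powr_ge_zero)
          have C2: "1 \<le> C\<^sup>2" using C(1) by simp
          have "I \<le> C\<^sup>2 * (P * J)"
            using \<open>I \<le> J\<close> J mult_mono[OF C2 mult_right_mono[OF P(1) J]] P by simp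
          moreover have "C\<^sup>2 \<le> C\<^sup>2 * P" using mult_left_mono[OF P(1), of "C\<^sup>2"] by simp
          moreover have "2 * C\<^sup>2 * ln T \<le> C\<^sup>2 * P" using mult_left_mono[OF P(2), of "C\<^sup>2"] by (simp add: mult_ac)
          moreover have "0 \<le> C\<^sup>2 * (P * J)" "0 \<le> C\<^sup>2" using J P by simp_all
          moreover have "14 * C\<^sup>2 * (P * (1 + J)) = 14 * (C\<^sup>2 * P) + 14 * (C\<^sup>2 * (P * J))"
            by (simp add: algebra_simps)
          ultimately show ?thesis unfolding P_def[symmetric] by linarith
        qed
        finally have "\<rho> * (norm (zeta (Complex (1 / 2 + \<rho>) u)))\<^sup>2 \<le> exp (9 / 4) * (14 * C\<^sup>2 * (T powr (\<eta> / 4) * (1 + J)))"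
          by simp
        then show "(norm (zeta (Complex (1 / 2 + \<rho>) u)))\<^sup>2 \<le> K * T powr (\<eta> / 4) * (1 + J)"
          unfolding K_def using \<rho>(1) by (simp add: field_simps)
      qed (use T t HG in auto)
      also have "\<dots> = (exp 1 * K) * T powr (\<eta> / 4) * T powr (8 * \<rho>) * (1 + J)" by simp
      also have "\<dots> \<le> T powr (\<eta> / 4) * T powr (\<eta> / 4) * T powr (\<eta> / 2) * (1 + J)"
        using T J \<rho>(3) by (intro mult_mono powr_mono) auto
      also have "\<dots> = T powr (\<eta> / 4 + \<eta> / 4 + \<eta> / 2) * (1 + J)" by (simp only: powr_add)
      also have "\<eta> / 4 + \<eta> / 4 + \<eta> / 2 = \<eta>" by simp
      finally show "zeta_sq t \<le> T powr \<eta> * (1 + (mean_sq (t + T powr \<eta>) - mean_sq (t - T powr \<eta>)))"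
        by (simp add: J_def G_def)
    qed
  qed
qed

section \<open>Splitting by the size of the window integral\<close>

text \<open>
  This caps the window integrals \<open>J\<close> at \<open>T^(3 \<eta>) t\<close>, so that the scale \<open>L\<close> attached to \<open>t\<close> below is smaller than \<open>t\<close> and
  the neighbouring blocks stay inside \<open>[0, 2T]\<close>.
\<close>

lemma zeta_sq_le_convexity:
  assumes "\<eta> > 0"
  shows "\<forall>\<^sub>F T in at_top. \<forall>t. 0 \<le> t \<and> t \<le> 2 * T \<longrightarrow> zeta_sq t \<le> T powr \<eta> * (1 + t)"
proof -
  define \<delta> where "\<delta> = min (1 / 2) (\<eta> / 4)"
  have \<delta>: "0 < \<delta>" "\<delta> \<le> 1 / 2" "2 * \<delta> \<le> \<eta> / 2" using assms by (auto simp: \<delta>_def)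
  obtain C where C: "C \<ge> 1" "\<And>s \<theta>. \<bar>Im s\<bar> \<ge> 1 \<Longrightarrow> 0 \<le> \<theta> \<Longrightarrow> \<theta> \<le> 1 \<Longrightarrow> Re s \<ge> 1 + \<delta> - \<theta> \<Longrightarrow>
      norm (zeta s) \<le> C * norm s powr \<theta>"
    using norm_zeta_le[OF \<delta>(1)] by auto
  have "compact (zeta_sq ` {0..1})"
    by (intro compact_continuous_image continuous_on_zeta_sq) auto
  then obtain B where B: "\<And>t. t \<in> {0..1} \<Longrightarrow> zeta_sq t \<le> B"
    using compact_imp_bounded bounded_imp_bdd_above unfolding bdd_above_def by (metis imageI)
  have "\<forall>\<^sub>F T in at_top. T \<ge> (1 :: real)" by real_asymp
  moreover have "\<forall>\<^sub>F T in at_top. B \<le> T powr \<eta>" using assms by real_asymp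
  moreover have "\<forall>\<^sub>F T in at_top. C\<^sup>2 * 2 * (4 * T) powr (\<eta> / 2) \<le> T powr \<eta>" using assms by real_asymp
  ultimately show ?thesis
  proof eventually_elim
    case (elim T)
    show ?case
    proof (intro allI impI)
      fix t assume t: "0 \<le> t \<and> t \<le> 2 * T"
      have T\<eta>: "T powr \<eta> \<ge> 0" by simp
      show "zeta_sq t \<le> T powr \<eta> * (1 + t)"
      proof (cases "t \<le> 1")
        case True
        then have "zeta_sq t \<le> T powr \<eta> * 1" using B[of t] t elim by simp
        also have "\<dots> \<le> T powr \<eta> * (1 + t)" using t by (intro mult_left_mono) auto
        finally show ?thesis .
      next
        case False
        let ?s = "Complex (1 / 2) t"
        have s: "norm ?s \<le> 2 * t" using cmod_le[of ?s] False by simp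
        have "norm (zeta ?s) \<le> C * norm ?s powr (1 / 2 + \<delta>)"
          using \<delta> False by (intro C(2)) auto
        also have "\<dots> \<le> C * (2 * t) powr (1 / 2 + \<delta>)"
          using s C(1) \<delta> by (intro mult_left_mono powr_mono2) auto
        finally have "zeta_sq t \<le> (C * (2 * t) powr (1 / 2 + \<delta>))\<^sup>2"
          unfolding zeta_sq_def by (intro power_mono) auto
        also have "(C * (2 * t) powr (1 / 2 + \<delta>))\<^sup>2 = C\<^sup>2 * ((2 * t) powr 1 * (2 * t) powr (2 * \<delta>))"
        proof -
          have "((2 * t) powr (1 / 2 + \<delta>))\<^sup>2 = (2 * t) powr 1 * (2 * t) powr (2 * \<delta>)"
            unfolding power2_eq_square powr_add[symmetric] by (simp add: algebra_simps)
          then show ?thesis by (simp only: power_mult_distrib)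
        qed
        also have "(2 * t) powr (2 * \<delta>) \<le> (2 * t) powr (\<eta> / 2)"
          using False \<delta> by (intro powr_mono) auto
        also have "(2 * t) powr (\<eta> / 2) \<le> (2 * (2 * T)) powr (\<eta> / 2)"
          using t assms by (intro powr_mono2) auto
        finally have "zeta_sq t \<le> C\<^sup>2 * (2 * t * (2 * (2 * T)) powr (\<eta> / 2))"
          using False by (simp add: mult_left_mono)
        also have "\<dots> = (C\<^sup>2 * 2 * (4 * T) powr (\<eta> / 2)) * t" by simp
        also have "\<dots> \<le> T powr \<eta> * t" using elim t by (intro mult_right_mono) auto
        also have "\<dots> \<le> T powr \<eta> * (1 + t)" by (intro mult_left_mono) auto
        finally show ?thesis .
      qed
    qed
  qed
qed

lemma Estar_diff_ge_powr:
  assumes "\<eta> > 0"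
  shows "\<forall>\<^sub>F T in at_top. \<forall>u v. 0 \<le> u \<and> u + 1 \<le> v \<and> v \<le> 2 * T \<longrightarrow>
    Estar v - Estar u \<ge> mean_sq v - mean_sq u - T powr \<eta> * (v - u)"
proof -
  obtain C where C: "C > 0" "\<And>n. n > 0 \<Longrightarrow> real (divisor_count n) \<le> C * real n powr (\<eta> / 2)"
    using divisor_count_bound[of "\<eta> / 2"] assms by auto
  have "\<forall>\<^sub>F T in at_top. 4 * (C * (2 * T) powr (\<eta> / 2)) * 5 \<le> T powr \<eta>" using assms C(1) by real_asymp
  moreover have "\<forall>\<^sub>F T in at_top. T \<ge> (1 :: real)" by real_asymp
  ultimately show ?thesis
  proof eventually_elim
    case (elim T)
    show ?case
    proof (intro allI impI)
      fix u v assume uv: "0 \<le> u \<and> u + 1 \<le> v \<and> v \<le> 2 * T"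
      define B where "B = C * (2 * T) powr (\<eta> / 2)"
      have B: "B \<ge> 0" using C by (simp add: B_def)
      have "Estar v - Estar u \<ge> mean_sq v - mean_sq u - 4 * B * (v - u + pi)"
      proof (rule Estar_diff_ge)
        fix n :: nat assume n: "1 \<le> n" "real n \<le> v"
        then have "real (divisor_count n) \<le> C * real n powr (\<eta> / 2)" by (intro C(2)) auto
        also have "\<dots> \<le> B" unfolding B_def using C(1) n uv assms by (intro mult_left_mono powr_mono2) auto
        finally show "real (divisor_count n) \<le> B" .
      qed (use uv B in auto)
      moreover have "4 * B * (v - u + pi) \<le> T powr \<eta> * (v - u)"
      proof -
        have "v - u \<ge> 1" using uv by simp
        then have "v - u + pi \<le> 5 * (v - u)" using pi_less_4
          by (simp add: algebra_simps)
        then have "4 * B * (v - u + pi) \<le> 4 * B * (5 * (v - u))" using B by (intro mult_left_mono) auto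
        also have "\<dots> = (4 * B * 5) * (v - u)" by simp
        also have "\<dots> \<le> T powr \<eta> * (v - u)" using elim uv by (intro mult_right_mono) (auto simp: B_def)
        finally show ?thesis .
      qed
      ultimately show "Estar v - Estar u \<ge> mean_sq v - mean_sq u - T powr \<eta> * (v - u)" by linarith
    qed
  qed
qed

text \<open>
  The majorant of \<open>w^(k+1)\<close> at the scale \<open>L\<close>, up to powers of \<open>G\<close>. The parameter \<open>G\<close> stands for \<open>T^\<eta>\<close>. The condition
  \<open>3 L \<le> t\<close> keeps a block containing \<open>t\<close> two block lengths away from 0.
\<close>

definition large_part :: "real \<Rightarrow> real \<Rightarrow> real \<Rightarrow> real \<Rightarrow> real \<Rightarrow> real" where
  "large_part T G k L t =
     (if 3 * L \<le> t \<and> t \<le> T \<and> G ^ 4 * L \<le> mean_sq (t + G) - mean_sq (t - G)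
      then zeta_sq t * L * (mean_sq (t + G) - mean_sq (t - G)) powr (k - 1) else 0)"

lemma large_part_integrable:
  assumes "0 \<le> a" "0 \<le> L" "0 \<le> G" "k \<ge> 1"
  shows "large_part T G k L integrable_on {a..b}"
proof -
  have "compact (zeta_sq ` {a..b})"
    by (intro compact_continuous_image continuous_on_zeta_sq) auto
  then obtain B where B: "\<And>t. t \<in> {a..b} \<Longrightarrow> zeta_sq t \<le> B"
    using compact_imp_bounded bounded_imp_bdd_above unfolding bdd_above_def by (metis imageI)
  show ?thesis
  proof (rule integrable_on_bounded_borel[where B = "\<bar>B\<bar> * L * (mean_sq (b + G)) powr (k - 1)"])
    show "large_part T G k L \<in> borel_measurable borel" unfolding large_part_def by measurable
    fix t assume t: "t \<in> {a..b}"
    have "mean_sq (t - G) \<le> mean_sq (t + G)" "mean_sq (t + G) \<le> mean_sq (b + G)" "mean_sq (t - G) \<ge> 0"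
      using t assms mean_sq_mono mean_sq_nonneg by auto
    then have "zeta_sq t * L * (mean_sq (t + G) - mean_sq (t - G)) powr (k - 1)
      \<le> \<bar>B\<bar> * L * (mean_sq (b + G)) powr (k - 1)"
      using B[OF t] assms zeta_sq_nonneg[of t] by (intro mult_mono powr_mono2) auto
    then show "\<bar>large_part T G k L t\<bar> \<le> \<bar>B\<bar> * L * (mean_sq (b + G)) powr (k - 1)"
      using assms zeta_sq_nonneg[of t] by (auto simp: large_part_def abs_mult)
  qed
qed

text \<open>
  Let \<open>X\<close> be the increment of \<open>I\<close> over the block enlarged by \<open>L\<close> on both sides. As \<open>G \<le> L\<close>, it bounds every
  window integral over \<open>[t - G, t + G]\<close> with \<open>t\<close> in the block, so the left hand side is at most \<open>L X^k\<close>. The pairs \<open>u\<close>, \<open>u + 4L\<close> enclose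
  the enlarged block, and the step function absorbs at most \<open>4 G L \<le> X/2\<close> of \<open>X\<close>.
\<close>

lemma integral_large_part_block_le:
  assumes k: "k \<ge> 1" and G: "G \<ge> 4" "G \<le> L" and a: "a \<ge> 2 * L"
    and S: "\<And>u v. 0 \<le> u \<Longrightarrow> u + 1 \<le> v \<Longrightarrow> v \<le> 2 * T \<Longrightarrow>
       Estar v - Estar u \<ge> mean_sq v - mean_sq u - G * (v - u)"
  shows "integral {a..a + L} (large_part T G k L)
     \<le> 4 powr k * integral {a - 2 * L..a + 3 * L} (\<lambda>t. \<bar>Estar t\<bar> powr k)"
proof (cases "\<exists>t\<in>{a..a + L}. 3 * L \<le> t \<and> t \<le> T \<and> G ^ 4 * L \<le> mean_sq (t + G) - mean_sq (t - G)")
  case False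
  then have "integral {a..a + L} (large_part T G k L) = integral {a..a + L} (\<lambda>t. 0)"
    by (intro Henstock_Kurzweil_Integration.integral_cong) (auto simp: large_part_def)
  then show ?thesis using integral_Estar_powr_nonneg by simp
next
  case True
  then obtain t where t: "t \<in> {a..a + L}" "3 * L \<le> t" "t \<le> T"
    "G ^ 4 * L \<le> mean_sq (t + G) - mean_sq (t - G)" by blast
  define X where "X = mean_sq (a + 2 * L) - mean_sq (a - L)"
  have J_le: "mean_sq (t + G) - mean_sq (t - G) \<le> X" if "t \<in> {a..a + L}" for t
    unfolding X_def using that G by (intro diff_mono mean_sq_mono) auto
  have X: "X \<ge> G ^ 4 * L" using t J_le by force
  have "8 * G \<le> G ^ 4"
  proof -
    have "8 * G \<le> 64 * G" using G by simp
    also have "64 * G = 4 ^ 3 * G" by simp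
    also have "\<dots> \<le> G ^ 3 * G" using G by (intro mult_right_mono power_mono) auto
    finally show ?thesis by (simp add: power_numeral_reduce)
  qed
  then have "8 * G * L \<le> X" using X G mult_right_mono[of "8 * G" "G ^ 4" L] by linarith
  have L: "L \<ge> 4" using G by simp
  have X0: "X > 0" using \<open>8 * G * L \<le> X\<close> G L mult_pos_pos[of "8 * G" L] by linarith
  have "integral {a..a + L} (large_part T G k L) \<le> integral {a..a + L} (\<lambda>t. L * X powr (k - 1) * zeta_sq t)"
  proof (rule integral_le)
    show "large_part T G k L integrable_on {a..a + L}"
      using a L G k by (intro large_part_integrable) auto
    show "(\<lambda>t. L * X powr (k - 1) * zeta_sq t) integrable_on {a..a + L}"
      by (intro integrable_on_mult_right zeta_sq_integrable)
    fix t assume t: "t \<in> {a..a + L}"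
    have "mean_sq (t + G) - mean_sq (t - G) \<ge> 0" using mean_sq_mono[of "t - G" "t + G"] G by simp
    then have "(mean_sq (t + G) - mean_sq (t - G)) powr (k - 1) \<le> X powr (k - 1)"
      using J_le[OF t] k by (intro powr_mono2) auto
    then have "zeta_sq t * L * (mean_sq (t + G) - mean_sq (t - G)) powr (k - 1) \<le> zeta_sq t * L * X powr (k - 1)"
      using zeta_sq_nonneg[of t] L by (intro mult_left_mono) auto
    then show "large_part T G k L t \<le> L * X powr (k - 1) * zeta_sq t"
      using zeta_sq_nonneg[of t] L by (auto simp: large_part_def mult_ac)
  qed
  also have "\<dots> = L * X powr (k - 1) * (mean_sq (a + L) - mean_sq a)"
    using a L by (subst mean_sq_diff) auto
  also have "\<dots> \<le> L * X powr (k - 1) * X"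
  proof (rule mult_left_mono)
    show "mean_sq (a + L) - mean_sq a \<le> X" unfolding X_def using L by (intro diff_mono mean_sq_mono) auto
  qed (use L in auto)
  also have "\<dots> = 4 powr k * (L * (X / 2 / 2) powr k)"
  proof -
    have "X powr (k - 1) * X = X powr k" using X0 by (simp add: powr_diff)
    moreover have "4 powr k * (X / 2 / 2) powr k = X powr k"
      using X0 by (simp flip: powr_mult)
    ultimately show ?thesis by (simp add: mult.assoc mult.left_commute)
  qed
  also have "L * (X / 2 / 2) powr k \<le> integral {a - 2 * L..a + 3 * L} (\<lambda>t. \<bar>Estar t\<bar> powr k)"
  proof -
    have "((a - L) - (a - 2 * L)) * (X / 2 / 2) powr k
      \<le> integral {a - 2 * L..(a - L) + 4 * L} (\<lambda>t. \<bar>Estar t\<bar> powr k)"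
    proof (rule integral_Estar_powr_ge)
      fix u assume u: "a - 2 * L \<le> u" "u < a - L"
      have "mean_sq (u + 4 * L) - mean_sq u \<ge> X"
        unfolding X_def using u by (intro diff_mono mean_sq_mono) auto
      moreover have "Estar (u + 4 * L) - Estar u \<ge> mean_sq (u + 4 * L) - mean_sq u - G * (u + 4 * L - u)"
        using u a L t by (intro S) auto
      moreover have "G * (u + 4 * L - u) = 4 * G * L" by simp
      ultimately show "Estar (u + 4 * L) - Estar u \<ge> X / 2" using \<open>8 * G * L \<le> X\<close> by linarith
    qed (use k a L X0 in auto)
    then show ?thesis by (simp add: add.commute)
  qed
  finally show ?thesis by (simp add: mult_left_mono)
qed

text \<open>
  The enlarged blocks have length \<open>5L\<close> and start at multiples of \<open>L\<close>, so they cover each point at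
  most five times.
\<close>

lemma integral_large_part_le:
  assumes k: "k \<ge> 1" and G: "G \<ge> 4" "G \<le> L" and T: "T \<ge> 0"
    and S: "\<And>u v. 0 \<le> u \<Longrightarrow> u + 1 \<le> v \<Longrightarrow> v \<le> 2 * T \<Longrightarrow>
       Estar v - Estar u \<ge> mean_sq v - mean_sq u - G * (v - u)"
  shows "integral {0..T} (large_part T G k L)
     \<le> 5 * 4 powr k * integral {0..2 * T} (\<lambda>t. \<bar>Estar t\<bar> powr k)"
proof (cases "3 * L \<le> T")
  case False
  then have "integral {0..T} (large_part T G k L) = integral {0..T} (\<lambda>t. 0)"
    by (intro Henstock_Kurzweil_Integration.integral_cong) (auto simp: large_part_def)
  then show ?thesis using integral_Estar_powr_nonneg by simp
next
  case True
  have L: "L \<ge> 4" using G by simp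
  define P where "P i = integral {0..real i * L} (\<lambda>t. \<bar>Estar t\<bar> powr k)" for i
  have P_mono: "P i \<le> P j" if "i \<le> j" for i j
    unfolding P_def using that L k by (intro integral_Estar_powr_subset) (auto intro: mult_right_mono)
  have int: "large_part T G k L integrable_on {a..b}" if "a \<ge> 0" for a b
    using that L G k by (intro large_part_integrable) auto
  \<comment> \<open>The block from \<open>(m + 2) L\<close> costs \<open>4 powr k * (P (m + 5) - P m)\<close>; the five-term sum is what telescoping leaves.\<close>
  have blocks: "integral {0..real (m + 2) * L} (large_part T G k L)
      \<le> 4 powr k * (P m + P (m + 1) + P (m + 2) + P (m + 3) + P (m + 4))" for m
  proof (induction m)
    case 0
    have "integral {0..real (0 + 2) * L} (large_part T G k L) = integral {0..real (0 + 2) * L} (\<lambda>t. 0)"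
      using L by (intro Henstock_Kurzweil_Integration.integral_cong) (auto simp: large_part_def)
    moreover have "P i \<ge> 0" for i unfolding P_def by (rule integral_Estar_powr_nonneg)
    ultimately show ?case by simp
  next
    case (Suc m)
    define a where "a = real (m + 2) * L"
    have a: "a \<ge> 2 * L" unfolding a_def using L by (intro mult_right_mono) auto
    have "integral {0..a + L} (large_part T G k L)
      = integral {0..a} (large_part T G k L) + integral {a..a + L} (large_part T G k L)"
      using a L by (intro Henstock_Kurzweil_Integration.integral_combine[symmetric] int) auto
    also have "integral {a..a + L} (large_part T G k L)
      \<le> 4 powr k * integral {a - 2 * L..a + 3 * L} (\<lambda>t. \<bar>Estar t\<bar> powr k)"
      by (rule integral_large_part_block_le[OF k G a S])
    also have "integral {a - 2 * L..a + 3 * L} (\<lambda>t. \<bar>Estar t\<bar> powr k) = P (m + 5) - P m"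
    proof -
      have "integral {0..a - 2 * L} (\<lambda>t. \<bar>Estar t\<bar> powr k) + integral {a - 2 * L..a + 3 * L} (\<lambda>t. \<bar>Estar t\<bar> powr k)
        = integral {0..a + 3 * L} (\<lambda>t. \<bar>Estar t\<bar> powr k)"
        using a L k by (intro Henstock_Kurzweil_Integration.integral_combine Estar_powr_integrable) auto
      moreover have "a - 2 * L = real m * L" "a + 3 * L = real (m + 5) * L"
        by (simp_all add: a_def algebra_simps)
      ultimately show ?thesis by (simp add: P_def)
    qed
    also have "integral {0..a} (large_part T G k L) \<le> 4 powr k * (P m + P (m + 1) + P (m + 2) + P (m + 3) + P (m + 4))"
      using Suc unfolding a_def .
    finally have "integral {0..a + L} (large_part T G k L)
      \<le> 4 powr k * (P (m + 1) + P (m + 2) + P (m + 3) + P (m + 4) + P (m + 5))"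
      by (simp add: algebra_simps)
    moreover have "a + L = real (Suc m + 2) * L" by (simp add: a_def algebra_simps)
    ultimately show ?case by (simp add: eval_nat_numeral)
  qed
  define m where "m = nat \<lceil>T / L\<rceil> - 2"
  have TL: "3 \<le> T / L" using True L by (simp add: field_simps)
  then have m: "T / L \<le> real (m + 2)" "real (m + 2) \<le> T / L + 1" unfolding m_def by linarith+
  have "integral {0..T} (large_part T G k L) \<le> integral {0..real (m + 2) * L} (large_part T G k L)"
  proof (rule integral_subset_le)
    show "{0..T} \<subseteq> {0..real (m + 2) * L}" using m(1) L by (auto simp: field_simps)
    show "\<forall>t\<in>{0..real (m + 2) * L}. large_part T G k L t \<ge> 0"
      using zeta_sq_nonneg L by (simp add: large_part_def)
  qed (auto intro: int)
  also note blocks[of m]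
  also have "P m + P (m + 1) + P (m + 2) + P (m + 3) + P (m + 4) \<le> 5 * P (m + 4)"
    using P_mono[of m "m + 4"] P_mono[of "m + 1" "m + 4"] P_mono[of "m + 2" "m + 4"] P_mono[of "m + 3" "m + 4"]
    by simp
  also have "P (m + 4) \<le> integral {0..2 * T} (\<lambda>t. \<bar>Estar t\<bar> powr k)"
  proof -
    have "real (m + 4) \<le> T / L + 3" using m by simp
    then have "real (m + 4) * L \<le> T + 3 * L" using L by (simp add: field_simps)
    then show ?thesis unfolding P_def using k True by (intro integral_Estar_powr_subset) auto
  qed
  finally show ?thesis by (simp add: mult_left_mono)
qed

text \<open>
  The first term covers \<open>t < 2 G\<close> and window integrals \<open>J\<close> up to \<open>G ^ 5\<close>. Otherwise \<open>J\<close> lies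
  between \<open>G ^ (4 + j)\<close> and \<open>G ^ (5 + j)\<close> for some \<open>j \<ge> 1\<close>, and in \<open>w J^k\<close> one factor \<open>J\<close> is
  replaced by \<open>G ^ 5 * G ^ j\<close>.
\<close>

lemma zeta_sq_powr_le_sum_large_part:
  assumes k: "k \<ge> 1" and G: "G \<ge> 4" and N: "G ^ N = T" and t: "0 \<le> t" "t \<le> T"
    and W: "\<And>t. 0 \<le> t \<Longrightarrow> t \<le> 2 * T \<Longrightarrow> zeta_sq t \<le> G * (1 + t)"
    and P: "\<And>t. 2 * G \<le> t \<Longrightarrow> t \<le> T \<Longrightarrow> zeta_sq t \<le> G * (1 + (mean_sq (t + G) - mean_sq (t - G)))"
  shows "zeta_sq t powr (k + 1) \<le> (2 * G ^ 6) powr (k + 1)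
     + (2 * G) powr k * G ^ 5 * (\<Sum>j\<in>{1..<N}. large_part T G k (G ^ j) t)"
proof -
  define J where "J = mean_sq (t + G) - mean_sq (t - G)"
  have lp0: "large_part T G k (G ^ j) t \<ge> 0" for j
    using zeta_sq_nonneg[of t] G by (simp add: large_part_def)
  have small: ?thesis if "zeta_sq t \<le> 2 * G ^ 6"
  proof -
    have "zeta_sq t powr (k + 1) \<le> (2 * G ^ 6) powr (k + 1)"
      using that zeta_sq_nonneg k by (intro powr_mono2) auto
    moreover have "0 \<le> (2 * G) powr k * G ^ 5 * (\<Sum>j\<in>{1..<N}. large_part T G k (G ^ j) t)"
      using G by (intro mult_nonneg_nonneg sum_nonneg lp0) auto
    ultimately show ?thesis by linarith
  qed
  have G5: "1 \<le> G ^ 5" using G by (intro one_le_power) auto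
  consider "t < 2 * G" | "2 * G \<le> t" "J \<le> G ^ 5" | "2 * G \<le> t" "J > G ^ 5" by linarith
  then show ?thesis
  proof cases
    case 1
    have "zeta_sq t \<le> G * (1 + t)" using t by (intro W) auto
    also have "1 + t \<le> 2 * G ^ 5"
    proof -
      have "4 ^ 4 * G \<le> G ^ 4 * G" using G by (intro mult_right_mono power_mono) auto
      then have "256 * G \<le> G ^ 5" by (simp add: power_numeral_reduce mult_ac)
      then show ?thesis using 1 G by linarith
    qed
    finally show ?thesis using G by (intro small) (simp add: power_numeral_reduce mult_left_mono)
  next
    case 2
    have "zeta_sq t \<le> G * (1 + J)" unfolding J_def using t 2 by (intro P) auto
    also have "1 + J \<le> 2 * G ^ 5" using 2 G5 by simp
    finally show ?thesis using G by (intro small) (simp add: power_numeral_reduce mult_left_mono)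
  next
    case 3
    \<comment> \<open>The scale is \<open>G ^ j\<close>, where \<open>n = j + 5\<close> is the first exponent whose power exceeds \<open>J\<close>.\<close>
    define n where "n = (LEAST n. J < G ^ n)"
    obtain n0 where "J < G ^ n0" using real_arch_pow[of G J] G by auto
    then have n: "J < G ^ n" unfolding n_def by (rule LeastI)
    have "n > 5"
    proof (rule ccontr)
      assume "\<not> n > 5"
      then have "G ^ n \<le> G ^ 5" using G by (intro power_increasing) auto
      with n 3 show False by linarith
    qed
    define j where "j = n - 5"
    have j: "j \<ge> 1" "n = Suc (4 + j)" "n = 5 + j" using \<open>n > 5\<close> by (auto simp: j_def)
    have "\<not> J < G ^ (4 + j)" using not_less_Least[of "4 + j" "\<lambda>n. J < G ^ n"] j(2) by (simp add: n_def)
    then have Jge: "G ^ 4 * G ^ j \<le> J" by (simp add: power_add)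
    have Jless: "J < G ^ 5 * G ^ j" using n j(3) by (simp add: power_add)
    \<comment> \<open>The pointwise bound \<open>W\<close> caps \<open>J\<close>, which makes the scale short compared with \<open>t\<close>.\<close>
    have "J \<le> 4 * G\<^sup>2 * t"
    proof -
      have "J = integral {t - G..t + G} zeta_sq" unfolding J_def using 3 G by (intro mean_sq_diff) auto
      also have "\<dots> \<le> integral {t - G..t + G} (\<lambda>u. G * (1 + (t + G)))"
      proof (rule integral_le[OF zeta_sq_integrable integrable_const_ivl])
        fix u assume u: "u \<in> {t - G..t + G}"
        then have "zeta_sq u \<le> G * (1 + u)" using 3 t G by (intro W) auto
        also have "\<dots> \<le> G * (1 + (t + G))" using u G by (intro mult_left_mono) auto
        finally show "zeta_sq u \<le> G * (1 + (t + G))" .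
      qed
      also have "\<dots> = 2 * G\<^sup>2 * (1 + (t + G))" using G by (simp add: power2_eq_square)
      also have "\<dots> \<le> 2 * G\<^sup>2 * (2 * t)" using 3 G by (intro mult_left_mono) auto
      finally show ?thesis by simp
    qed
    then have "G\<^sup>2 * (G\<^sup>2 * G ^ j) \<le> G\<^sup>2 * (4 * t)" using Jge by (simp add: power_numeral_reduce power2_eq_square mult_ac)
    then have "G\<^sup>2 * G ^ j \<le> 4 * t" using G by (subst (asm) mult_le_cancel_left_pos) auto
    moreover have "4\<^sup>2 * G ^ j \<le> G\<^sup>2 * G ^ j" using G by (intro mult_right_mono power_mono) auto
    ultimately have Lt: "3 * G ^ j \<le> t" using t by simp
    have Gj0: "G ^ j > 0" using G by simp
    then have "G ^ j < G ^ N" using Lt t N by linarith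
    then have "j < N" using G power_less_imp_less_exp[of G j N] by simp
    have J1: "J \<ge> 1" using 3 G5 by linarith
    have lp: "large_part T G k (G ^ j) t = zeta_sq t * G ^ j * J powr (k - 1)"
      using Lt t Jge by (simp add: large_part_def J_def)
    have "zeta_sq t \<le> G * (1 + J)" unfolding J_def using t 3 by (intro P) auto
    also have "\<dots> \<le> G * (2 * J)" using J1 G by (intro mult_left_mono) auto
    finally have "zeta_sq t powr k \<le> (2 * G * J) powr k"
      using zeta_sq_nonneg k by (intro powr_mono2) (auto simp: mult_ac)
    also have "\<dots> = (2 * G) powr k * (J powr (k - 1) * J)"
      using J1 G by (simp add: powr_mult powr_diff)
    also have "\<dots> \<le> (2 * G) powr k * (J powr (k - 1) * (G ^ 5 * G ^ j))"
      using Jless G by (intro mult_left_mono) auto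
    finally have "zeta_sq t * zeta_sq t powr k \<le> zeta_sq t * ((2 * G) powr k * (J powr (k - 1) * (G ^ 5 * G ^ j)))"
      using zeta_sq_nonneg by (intro mult_left_mono)
    also have "\<dots> = (2 * G) powr k * G ^ 5 * large_part T G k (G ^ j) t" unfolding lp by (simp add: mult_ac)
    also have "\<dots> \<le> (2 * G) powr k * G ^ 5 * (\<Sum>j\<in>{1..<N}. large_part T G k (G ^ j) t)"
      using G \<open>j < N\<close> j(1) by (intro mult_left_mono member_le_sum lp0) auto
    also have "\<dots> \<le> (2 * G ^ 6) powr (k + 1) + \<dots>" by simp
    finally show ?thesis using zeta_sq_nonneg[of t] by (simp add: powr_add mult.commute)
  qed
qed

lemma integral_zeta_sq_powr_le:
  assumes k: "k \<ge> 1" and G: "G \<ge> 4" and N: "G ^ N = T"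
    and W: "\<And>t. 0 \<le> t \<Longrightarrow> t \<le> 2 * T \<Longrightarrow> zeta_sq t \<le> G * (1 + t)"
    and P: "\<And>t. 2 * G \<le> t \<Longrightarrow> t \<le> T \<Longrightarrow> zeta_sq t \<le> G * (1 + (mean_sq (t + G) - mean_sq (t - G)))"
    and S: "\<And>u v. 0 \<le> u \<Longrightarrow> u + 1 \<le> v \<Longrightarrow> v \<le> 2 * T \<Longrightarrow>
       Estar v - Estar u \<ge> mean_sq v - mean_sq u - G * (v - u)"
  shows "integral {0..T} (\<lambda>t. zeta_sq t powr (k + 1)) \<le> (2 * G ^ 6) powr (k + 1) * T
     + (2 * G) powr k * G ^ 5 * (real N * (5 * 4 powr k * integral {0..2 * T} (\<lambda>t. \<bar>Estar t\<bar> powr k)))"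
proof -
  have T: "T \<ge> 0" using N G by auto
  have int: "large_part T G k (G ^ j) integrable_on {0..T}" for j
    using G k by (intro large_part_integrable) auto
  have int_sum: "(\<lambda>t. \<Sum>j\<in>{1..<N}. large_part T G k (G ^ j) t) integrable_on {0..T}"
    by (intro integrable_sum int) auto
  have "integral {0..T} (\<lambda>t. zeta_sq t powr (k + 1)) \<le> integral {0..T} (\<lambda>t. (2 * G ^ 6) powr (k + 1)
     + (2 * G) powr k * G ^ 5 * (\<Sum>j\<in>{1..<N}. large_part T G k (G ^ j) t))"
  proof (rule integral_le)
    show "(\<lambda>t. zeta_sq t powr (k + 1)) integrable_on {0..T}"
      using k zeta_sq_nonneg by (intro integrable_continuous_interval continuous_on_powr' continuous_on_zeta_sq continuous_on_const) auto
    show "(\<lambda>t. (2 * G ^ 6) powr (k + 1) + (2 * G) powr k * G ^ 5 *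
       (\<Sum>j\<in>{1..<N}. large_part T G k (G ^ j) t)) integrable_on {0..T}"
      by (intro integrable_add integrable_const_ivl integrable_on_mult_right int_sum)
    fix t assume "t \<in> {0..T}"
    then show "zeta_sq t powr (k + 1) \<le> (2 * G ^ 6) powr (k + 1)
     + (2 * G) powr k * G ^ 5 * (\<Sum>j\<in>{1..<N}. large_part T G k (G ^ j) t)"
      using k G by (intro zeta_sq_powr_le_sum_large_part N W P) auto
  qed
  also have "\<dots> = (2 * G ^ 6) powr (k + 1) * T + (2 * G) powr k * G ^ 5 *
     (\<Sum>j\<in>{1..<N}. integral {0..T} (large_part T G k (G ^ j)))"
    using T int by (subst integral_add) (auto intro!: integrable_const_ivl integrable_on_mult_right int_sum simp: integral_sum simp del: One_nat_def)
  also have "(\<Sum>j\<in>{1..<N}. integral {0..T} (large_part T G k (G ^ j)))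
     \<le> real (card {1..<N}) * (5 * 4 powr k * integral {0..2 * T} (\<lambda>t. \<bar>Estar t\<bar> powr k))"
  proof (rule sum_bounded_above)
    fix j assume "j \<in> {1..<N}"
    then have "G ^ 1 \<le> G ^ j" using G by (intro power_increasing) auto
    then show "integral {0..T} (large_part T G k (G ^ j)) \<le> 5 * 4 powr k * integral {0..2 * T} (\<lambda>t. \<bar>Estar t\<bar> powr k)"
      using k G T S by (intro integral_large_part_le) auto
  qed
  also have "\<dots> \<le> real N * (5 * 4 powr k * integral {0..2 * T} (\<lambda>t. \<bar>Estar t\<bar> powr k))"
    by (intro mult_right_mono mult_nonneg_nonneg integral_Estar_powr_nonneg) auto
  finally show ?thesis using G by (simp add: mult_left_mono)
qed

section \<open>The moment bound\<close>

text \<open>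
  An exponent \<open>a < 1\<close> would contradict the linear growth of the moments.
\<close>

lemma moment_exponent_ge_1:
  assumes "k \<ge> 0" and bound: "\<And>T. T \<ge> 2 \<Longrightarrow> integral {0..T} (\<lambda>t. \<bar>Estar t\<bar> powr k) \<le> C * T powr a"
  shows "a \<ge> 1"
proof (rule ccontr)
  assume "\<not> a \<ge> 1"
  then have "\<forall>\<^sub>F T in at_top. C * T powr a < T / pi - 1" by real_asymp
  then have "\<forall>\<^sub>F T in at_top. C * T powr a < T / pi - 1 \<and> T \<ge> 2"
    using eventually_ge_at_top eventually_conj by blast
  then obtain T where T: "C * T powr a < T / pi - 1" "T \<ge> 2"
    by (auto simp: eventually_at_top_linorder)
  have "T / pi - 1 \<le> integral {0..T} (\<lambda>t. \<bar>Estar t\<bar> powr k)"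
    using assms(1) T by (intro integral_Estar_powr_ge_linear) auto
  also have "\<dots> \<le> C * T powr a" using T by (intro bound)
  finally show False using T by simp
qed

lemma norm_zeta_powr_eq: "norm (zeta (Complex (1 / 2) t)) powr (2 * k + 2) = zeta_sq t powr (k + 1)"
proof -
  have "zeta_sq t = norm (zeta (Complex (1 / 2) t)) powr 2"
    unfolding zeta_sq_def by (cases "zeta (Complex (1 / 2) t) = 0") (simp_all add: powr_numeral)
  then have "zeta_sq t powr (k + 1) = norm (zeta (Complex (1 / 2) t)) powr (2 * (k + 1))"
    by (simp only: powr_powr)
  then show ?thesis by (simp add: distrib_left)
qed

text \<open>
  For monotone \<open>F\<close> a bounded range of \<open>T\<close> only affects the constant, because \<open>T powr a \<ge> 1\<close>.
\<close>

lemma bound_of_eventually_bound: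
  fixes F :: "real \<Rightarrow> real"
  assumes ev: "\<forall>\<^sub>F T in at_top. F T \<le> C * T powr a" and "a \<ge> 0" and mono: "\<And>S T. 0 \<le> S \<Longrightarrow> S \<le> T \<Longrightarrow> F S \<le> F T"
  shows "\<exists>C. \<forall>T\<ge>2. F T \<le> C * T powr a"
proof -
  obtain T0 where T0: "\<And>T. T \<ge> T0 \<Longrightarrow> F T \<le> C * T powr a"
    using ev by (auto simp: eventually_at_top_linorder)
  define D where "D = max C \<bar>F (max T0 2)\<bar>"
  have "F T \<le> D * T powr a" if "T \<ge> 2" for T
  proof (cases "T \<ge> T0")
    case True
    then have "F T \<le> C * T powr a" by (rule T0)
    also have "\<dots> \<le> D * T powr a" by (intro mult_right_mono) (auto simp: D_def)
    finally show ?thesis .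
  next
    case False
    then have "F T \<le> F (max T0 2)" using that by (intro mono) auto
    also have "\<dots> \<le> D * 1" by (auto simp: D_def)
    also have "\<dots> \<le> D * T powr a"
      using that assms(2) by (intro mult_left_mono ge_one_powr_ge_zero) (auto simp: D_def)
    finally show ?thesis .
  qed
  then show ?thesis by blast
qed

theorem theorem4:
  fixes k c :: real
  assumes "k \<ge> 1"
    and "\<forall>\<epsilon>>0. \<exists>C. \<forall>T\<ge>2.
           integral {0..T} (\<lambda>t. \<bar>Estar t\<bar> powr k) \<le> C * T powr (c + \<epsilon>)"
  shows "\<forall>\<epsilon>>0. \<exists>C. \<forall>T\<ge>2.
           integral {0..T} (\<lambda>t. norm (zeta (Complex (1/2) t)) powr (2 * k + 2))
             \<le> C * T powr (c + \<epsilon>)"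
proof (intro allI impI)
  fix \<epsilon> :: real assume \<epsilon>: "\<epsilon> > 0"
  have "1 \<le> c"
  proof (rule field_le_epsilon)
    fix e :: real assume "e > 0"
    then obtain C where "\<And>T. T \<ge> 2 \<Longrightarrow> integral {0..T} (\<lambda>t. \<bar>Estar t\<bar> powr k) \<le> C * T powr (c + e)"
      using assms(2) by blast
    then show "1 \<le> c + e" using assms(1) by (intro moment_exponent_ge_1[of k]) auto
  qed
  obtain C where C: "\<And>T. T \<ge> 2 \<Longrightarrow> integral {0..T} (\<lambda>t. \<bar>Estar t\<bar> powr k) \<le> C * T powr (c + \<epsilon> / 2)"
    using assms(2) \<epsilon> half_gt_zero by blast
  \<comment> \<open>The splitting loses the factor \<open>G ^ (6 (k + 1))\<close>, which for \<open>G = T powr (1 / N)\<close> is at most \<open>T powr (\<epsilon> / 2)\<close>.\<close>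
  define N where "N = nat \<lceil>12 * (k + 1) / \<epsilon>\<rceil>"
  have "12 * (k + 1) / \<epsilon> > 0" using assms(1) \<epsilon> by simp
  then have N: "real N > 0" "12 * (k + 1) / \<epsilon> \<le> real N" unfolding N_def by linarith+
  define \<eta> where "\<eta> = 1 / real N"
  have \<eta>: "\<eta> > 0" "6 * (k + 1) * \<eta> \<le> \<epsilon> / 2" using N \<epsilon> by (auto simp: \<eta>_def field_simps)
  define D where "D = 2 powr (k + 1) + 2 powr k * (real N * (5 * 4 powr k * (\<bar>C\<bar> * 2 powr (c + \<epsilon> / 2))))"
  have "\<exists>C. \<forall>T\<ge>2. integral {0..T} (\<lambda>t. zeta_sq t powr (k + 1)) \<le> C * T powr (c + \<epsilon>)"
  proof (rule bound_of_eventually_bound)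
    have int: "(\<lambda>t. zeta_sq t powr (k + 1)) integrable_on {0..T}" for T
      using assms(1) zeta_sq_nonneg
      by (intro integrable_continuous_interval continuous_on_powr' continuous_on_zeta_sq continuous_on_const) auto
    show "integral {0..S} (\<lambda>t. zeta_sq t powr (k + 1)) \<le> integral {0..T} (\<lambda>t. zeta_sq t powr (k + 1))"
      if "0 \<le> S" "S \<le> T" for S T
      using that by (intro integral_subset_le int) auto
    show "c + \<epsilon> \<ge> 0" using \<open>1 \<le> c\<close> \<epsilon> by simp
    have "\<forall>\<^sub>F T in at_top. T powr \<eta> \<ge> 4" using \<eta>(1) by real_asymp
    moreover have "\<forall>\<^sub>F T in at_top. T \<ge> (2 :: real)" by real_asymp
    ultimately show "\<forall>\<^sub>F T in at_top. integral {0..T} (\<lambda>t. zeta_sq t powr (k + 1)) \<le> D * T powr (c + \<epsilon>)"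
      using zeta_sq_le_convexity[OF \<eta>(1)] zeta_sq_le_local_mean[OF \<eta>(1)] Estar_diff_ge_powr[OF \<eta>(1)]
    proof eventually_elim
      case (elim T)
      define G where "G = T powr \<eta>"
      have G: "G \<ge> 4" using elim by (simp add: G_def)
      have T: "T \<ge> 2" by fact
      have "G ^ N = T" unfolding G_def \<eta>_def using N(1) T by (simp add: powr_powr flip: powr_realpow)
      then have "integral {0..T} (\<lambda>t. zeta_sq t powr (k + 1)) \<le> (2 * G ^ 6) powr (k + 1) * T
        + (2 * G) powr k * G ^ 5 * (real N * (5 * 4 powr k * integral {0..2 * T} (\<lambda>t. \<bar>Estar t\<bar> powr k)))"
        using elim by (intro integral_zeta_sq_powr_le[OF assms(1) G]) (auto simp: G_def)
      also have "(2 * G ^ 6) powr (k + 1) * T \<le> 2 powr (k + 1) * T powr (c + \<epsilon>)"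
      proof -
        have "(2 * G ^ 6) powr (k + 1) = 2 powr (k + 1) * T powr (6 * (k + 1) * \<eta>)"
          unfolding G_def using T by (simp add: powr_mult powr_powr powr_power mult_ac)
        moreover have "T powr (6 * (k + 1) * \<eta>) * T powr 1 \<le> T powr (c + \<epsilon>)"
          using T \<eta>(2) \<open>1 \<le> c\<close> \<epsilon> unfolding powr_add[symmetric] by (intro powr_mono) auto
        ultimately show ?thesis using T by (simp add: mult.assoc)
      qed
      also have "(2 * G) powr k * G ^ 5 * (real N * (5 * 4 powr k * integral {0..2 * T} (\<lambda>t. \<bar>Estar t\<bar> powr k)))
        \<le> 2 powr k * T powr (\<epsilon> / 2) * (real N * (5 * 4 powr k * (\<bar>C\<bar> * 2 powr (c + \<epsilon> / 2) * T powr (c + \<epsilon> / 2))))"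
      proof (rule mult_mono)
        have "(2 * G) powr k * G ^ 5 = 2 powr k * T powr ((k + 5) * \<eta>)"
          unfolding G_def using T by (simp add: powr_mult powr_powr powr_power mult_ac distrib_left powr_add)
        moreover have "(k + 5) * \<eta> \<le> 6 * (k + 1) * \<eta>" using assms(1) \<eta>(1) by (intro mult_right_mono) auto
        then have "T powr ((k + 5) * \<eta>) \<le> T powr (\<epsilon> / 2)" using T \<eta>(2) by (intro powr_mono) auto
        ultimately show "(2 * G) powr k * G ^ 5 \<le> 2 powr k * T powr (\<epsilon> / 2)" by simp
        have "integral {0..2 * T} (\<lambda>t. \<bar>Estar t\<bar> powr k) \<le> C * (2 * T) powr (c + \<epsilon> / 2)"
          using T by (intro C) auto
        also have "\<dots> \<le> \<bar>C\<bar> * (2 * T) powr (c + \<epsilon> / 2)" by (intro mult_right_mono) auto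
        also have "\<dots> = \<bar>C\<bar> * 2 powr (c + \<epsilon> / 2) * T powr (c + \<epsilon> / 2)" using T by (simp add: powr_mult)
        finally show "real N * (5 * 4 powr k * integral {0..2 * T} (\<lambda>t. \<bar>Estar t\<bar> powr k))
          \<le> real N * (5 * 4 powr k * (\<bar>C\<bar> * 2 powr (c + \<epsilon> / 2) * T powr (c + \<epsilon> / 2)))"
          by (intro mult_left_mono) auto
      qed (auto intro!: mult_nonneg_nonneg integral_Estar_powr_nonneg)
      also have "\<dots> = 2 powr k * (real N * (5 * 4 powr k * (\<bar>C\<bar> * 2 powr (c + \<epsilon> / 2)))) * (T powr (\<epsilon> / 2) * T powr (c + \<epsilon> / 2))"
        by (simp add: mult_ac)
      also have "T powr (\<epsilon> / 2) * T powr (c + \<epsilon> / 2) = T powr (c + \<epsilon>)"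
        unfolding powr_add[symmetric] by (simp add: add.commute)
      finally show ?case by (simp add: D_def distrib_right)
    qed
  qed
  then show "\<exists>C. \<forall>T\<ge>2. integral {0..T} (\<lambda>t. norm (zeta (Complex (1/2) t)) powr (2 * k + 2)) \<le> C * T powr (c + \<epsilon>)"
    by (simp only: norm_zeta_powr_eq)
qed

end
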